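(* Let $n\in\mathbb N$, $\overrightarrow{P}=(p_1,\dots,p_n)$ with $1\le p_1\le\cdots\le p_n<\infty$, and let $\chi$ be a kernel. For $w>0$ let $K_w(f)(\mathbf x)=\sum_{\mathbf k\in\mathbb Z^n}\chi(w\mathbf x-\mathbf k)\,w^n\int_{I_{\mathbf k,w}}f(\mathbf t)\,d\mathbf t$ with $I_{\mathbf k,w}=\prod_{j=1}^n[\frac{k_j}{w},\frac{k_j+1}{w}]$. Then for every $f\in L^{\overrightarrow P}(\mathbb R^n)$, $$\lim_{w\to\infty}\|K_wf-f\|_{\overrightarrow P}=0.$$
   Context: A kernel is a function $\chi:\mathbb R^n\to\mathbb R$ with $\chi\in L^1(\mathbb R^n)$, bounded in a neighborhood of the origin, such that $\sum_{\mathbf k\in\mathbb Z^n}\chi(\mathbf u-\mathbf k)=1$ for every $\mathbf u\in\mathbb R^n$, and for a fixed $\alpha\ge0$ the absolute moment $m_\alpha(\chi):=\sup_{\mathbf u\in\mathbb R^n}\sum_{\mathbf k\in\mathbb Z^n}|\chi(\mathbf u-\mathbf k)|\,\|\mathbf u-\mathbf k\|_2^\alpha$ is finite. $L^{\overrightarrow P}(\mathbb R^n)$ is the space of measurable $f:\mathbb R^n\to\mathbb R$ with $\|f\|_{\overrightarrow P}=\Big(\int_{\mathbb R}\cdots\Big(\int_{\mathbb R}\Big(\int_{\mathbb R}|f(x_1,\dots,x_n)|^{p_1}dx_1\Big)^{p_2/p_1}dx_2\Big)^{p_3/p_2}\cdots dx_n\Big)^{1/p_n}<\infty$. *)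

theory Defs
  imports "HOL-Analysis.Analysis"
begin

text \<open>Power on extended nonnegative reals (used with positive exponents only):
  infinity stays infinity.\<close>
definition epowr :: "ennreal \<Rightarrow> real \<Rightarrow> ennreal" where
  "epowr x r = (if x = \<infinity> then \<infinity> else ennreal (enn2real x powr r))"

definition npow :: "real \<Rightarrow> real \<Rightarrow> real" where
  "npow t a = (if a = 0 then 1 else t powr a)"

definition Zn :: "(real^'n::finite) set" where
  "Zn = {k. \<forall>i. k $ i \<in> \<int>}"

definition vupd :: "real^'n::finite \<Rightarrow> 'n \<Rightarrow> real \<Rightarrow> real^'n" where
  "vupd x i t = (\<chi> j. if j = i then t else x $ j)"

definition is_kernel :: "real \<Rightarrow> (real^'n::finite \<Rightarrow> real) \<Rightarrow> bool" where
  "is_kernel \<alpha> \<chi>f \<longleftrightarrow>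
     integrable lebesgue \<chi>f \<and>
     (\<exists>\<delta>>0. \<exists>M. \<forall>u. norm u < \<delta> \<longrightarrow> \<bar>\<chi>f u\<bar> \<le> M) \<and>
     (\<forall>u. ((\<lambda>k. \<chi>f (u - k)) has_sum 1) Zn) \<and>
     (\<exists>M. \<forall>u. (\<lambda>k. \<bar>\<chi>f (u - k)\<bar> * npow (norm (u - k)) \<alpha>) summable_on Zn \<and>
              (\<Sum>\<^sub>\<infinity>k\<in>Zn. \<bar>\<chi>f (u - k)\<bar> * npow (norm (u - k)) \<alpha>) \<le> M)"

text \<open>Iterated mixed-norm integration: coordinates are integrated in the order
  given by the list (first element = innermost integral, exponent P i).\<close>
fun mixnorm_aux :: "'n list \<Rightarrow> ('n \<Rightarrow> real) \<Rightarrow> (real^'n::finite \<Rightarrow> ennreal) \<Rightarrow> real^'n \<Rightarrow> ennreal" where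
  "mixnorm_aux [] P g x = g x"
| "mixnorm_aux (i # is) P g x =
     mixnorm_aux is P (\<lambda>y. epowr (\<integral>\<^sup>+ t. epowr (g (vupd y i t)) (P i) \<partial>lborel) (1 / P i)) x"

definition mixed_norm :: "('n::{finite,linorder} \<Rightarrow> real) \<Rightarrow> (real^'n::{finite,linorder} \<Rightarrow> real) \<Rightarrow> ennreal" where
  "mixed_norm P f = mixnorm_aux (sorted_list_of_set UNIV) P (\<lambda>x. ennreal \<bar>f x\<bar>) 0"

definition in_mixed_Lp :: "('n::{finite,linorder} \<Rightarrow> real) \<Rightarrow> (real^'n::{finite,linorder} \<Rightarrow> real) \<Rightarrow> bool" where
  "in_mixed_Lp P f \<longleftrightarrow> f \<in> borel_measurable lebesgue \<and> mixed_norm P f < \<infinity>"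

definition kantorovich :: "(real^'n::finite \<Rightarrow> real) \<Rightarrow> real \<Rightarrow> (real^'n \<Rightarrow> real) \<Rightarrow> real^'n \<Rightarrow> real" where
  "kantorovich \<chi>f w f x =
     (\<Sum>\<^sub>\<infinity>k\<in>Zn. \<chi>f (w *\<^sub>R x - k) * w ^ CARD('n) *
        set_lebesgue_integral lebesgue (cbox ((1 / w) *\<^sub>R k) ((1 / w) *\<^sub>R (k + 1))) f)"

end

theory Submission
  imports Defs
begin

text \<open>
  Writing \<open>\<lfloor>t\<rfloor>\<close> for the componentwise floor, a lattice sum over the cells of the Kantorovich operator is an
  integral, and \<open>\<bar>K\<^sub>w f - f\<bar>(x)\<close> is bounded by \<open>w\<^sup>n \<integral> \<bar>\<chi>(wx - \<lfloor>wt\<rfloor>)\<bar> \<bar>f(t) - f(x)\<bar> dt\<close>; the bound is trivial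
  where the series diverges. The key estimate concerns the positive operator
  \<open>T g(x) = w\<^sup>n \<integral> X(wx - \<lfloor>wt\<rfloor>) g(t) dt\<close> when the periodization of \<open>X\<close> is at most \<open>M\<close>: with \<open>q\<close> the last exponent,
  \<open>\<parallel>T g\<parallel> \<le> M powr (1 - 1/q) * \<parallel>X\<parallel>\<^sub>1 powr (1/q) * \<parallel>g\<parallel>\<close>. It is proved one coordinate at a time: since the exponents
  increase, Jensen's inequality applies, and integrating out a coordinate turns \<open>T\<close> into the operator of the
  same kind for the marginal of \<open>X\<close>, whose periodization is again at most \<open>M\<close>.

  The factor \<open>\<parallel>X\<parallel>\<^sub>1 powr (1/q)\<close> makes the tail \<open>\<chi> 1{\<bar>v\<bar> > R}\<close> negligible uniformly in \<open>w\<close> without any decay of the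
  kernel. This gives convergence for continuous compactly supported \<open>f\<close>, and density gives the general case.
\<close>

section \<open>Extended powers, coordinates and Fubini\<close>

text \<open>Two obstacles shape the proof. With \<alpha> = 0 allowed, the lattice sum of the tail of
  the kernel need not tend to 0 uniformly in the point; only its integral over a unit cell does. The
  operator estimate absorbs the part of the tail that acts on f(t). The part that carries f(x) is
  multiplication by the periodized tail, which is merely bounded; \<open>cell_kernel\<close>
  rewrites it as an operator of the same kind and of the same small mass, so that the same estimate
  applies.

  The second obstacle is measurability. Sections of a Lebesgue measurable function need not be
  measurable, so everything is estimated for Borel representatives of f and of the kernel. The
  original functions enter only through monotonicity of the mixed norm under almost everywhere
  inequalities, which is proved without any measurability.\<close>

lemma epowr_0 [simp]: "epowr 0 r = 0"
  by (simp add: epowr_def)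

lemma epowr_top [simp]: "epowr top r = top"
  by (simp add: epowr_def)

lemma epowr_ennreal: "0 \<le> x \<Longrightarrow> epowr (ennreal x) r = ennreal (x powr r)"
  by (simp add: epowr_def)

lemma epowr_one [simp]: "epowr x 1 = x"
  by (cases x) (simp_all add: epowr_ennreal)

lemma epowr_less_top_iff [simp]: "epowr x r < top \<longleftrightarrow> x < top"
  by (cases x) (simp_all add: epowr_ennreal)

lemma epowr_mono: "0 \<le> r \<Longrightarrow> x \<le> y \<Longrightarrow> epowr x r \<le> epowr y r"
  by (cases x; cases y) (auto simp: epowr_ennreal ennreal_leI powr_mono2 top_unique)

lemma epowr_eq_0_iff [simp]: "epowr x r = 0 \<longleftrightarrow> x = 0"
  by (cases x) (simp_all add: epowr_ennreal)

lemma epowr_mult: "epowr (x * y) r = epowr x r * epowr y r"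
proof -
  consider "x = 0 \<or> y = 0" | "x = top" "y \<noteq> 0" | "y = top" "x \<noteq> 0"
    | a b where "0 \<le> a" "0 \<le> b" "x = ennreal a" "y = ennreal b"
    by (metis ennreal_cases)
  then show ?thesis
  proof cases
    case 4
    then show ?thesis by (simp add: epowr_ennreal powr_mult flip: ennreal_mult)
  qed (auto simp: ennreal_top_mult ennreal_mult_top)
qed

lemma epowr_epowr: "epowr (epowr x r) s = epowr x (r * s)"
  by (cases x) (simp_all add: epowr_ennreal powr_powr)

lemma borel_measurable_epowr [measurable (raw)]:
  assumes [measurable]: "f \<in> borel_measurable M"
  shows "(\<lambda>x. epowr (f x) r) \<in> borel_measurable M"
  unfolding epowr_def by measurable

lemma tendsto_epowr_0:
  assumes "(f \<longlongrightarrow> 0) F" "0 < r"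
  shows "((\<lambda>x. epowr (f x) r) \<longlongrightarrow> 0) F"
proof (rule order_tendstoI)
  fix a :: ennreal assume a: "0 < a"
  obtain b where b: "0 < b" "epowr b r \<le> a"
  proof (cases a)
    case (real c)
    then have "epowr (ennreal (c powr (1/r))) r \<le> a"
      using \<open>0 < r\<close> by (simp add: epowr_ennreal powr_powr)
    moreover have "0 < ennreal (c powr (1/r))" using real a by (auto simp: ennreal_less_zero_iff)
    ultimately show ?thesis using that by blast
  next
    case top
    then show ?thesis using that[of 1] by simp
  qed
  \<comment> \<open>\<open>b\<close> yields only a weak bound by \<open>a\<close>; a point strictly
    below it makes the conclusion strict.\<close>
  obtain d where d: "0 < d" "d < b" using b(1) dense by blast
  have strict: "epowr d r < epowr b r"
    using d \<open>0 < r\<close> by (cases d; cases b) (auto simp: epowr_ennreal ennreal_lessI ennreal_less_iff intro!: powr_less_mono2)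
  have "\<forall>\<^sub>F x in F. f x < d" using order_tendstoD(2)[OF assms(1) d(1)] .
  then show "\<forall>\<^sub>F x in F. epowr (f x) r < a"
  proof eventually_elim
    case (elim x)
    have "epowr (f x) r \<le> epowr d r" using elim \<open>0 < r\<close> by (intro epowr_mono) auto
    also note strict
    also note b(2)
    finally show ?case .
  qed
qed simp

text \<open>Replacing a coordinate is a translation along an axis. This is how measurability and the
  translation invariance of \<open>lborel\<close> reach the integrals in
  \<open>mixnorm_aux\<close>.\<close>

lemma vupd_eq: "vupd x i t = x + (t - x $ i) *\<^sub>R axis i 1"
  by (auto simp: vupd_def vec_eq_iff axis_def)

lemma vupd_nth: "vupd x i t $ j = (if j = i then t else x $ j)"
  by (simp add: vupd_def)

lemma borel_measurable_vec_nth [measurable (raw)]: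
  fixes f :: "'a \<Rightarrow> real^'n"
  assumes [measurable]: "f \<in> borel_measurable M"
  shows "(\<lambda>x. f x $ i) \<in> borel_measurable M"
  by (rule measurable_compose[OF assms]) (intro borel_measurable_continuous_onI continuous_intros)

lemma borel_measurable_vupd [measurable (raw)]:
  assumes [measurable]: "f \<in> borel_measurable M" "g \<in> borel_measurable M"
  shows "(\<lambda>x. vupd (f x) i (g x)) \<in> borel_measurable M"
  unfolding vupd_eq by measurable

definition vec_floor :: "real^'n \<Rightarrow> real^'n" where
  "vec_floor x = (\<chi> i. of_int \<lfloor>x $ i\<rfloor>)"

lemma vec_floor_nth [simp]: "vec_floor x $ i = of_int \<lfloor>x $ i\<rfloor>"
  by (simp add: vec_floor_def)

lemma vec_eq_sum_axis: "(x::real^'n) = (\<Sum>i\<in>UNIV. (x $ i) *\<^sub>R axis i 1)"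
  by (simp add: vec_eq_iff axis_def sum.delta if_distrib cong: if_cong)

lemma borel_measurable_vec_floor [measurable (raw)]:
  fixes f :: "'a \<Rightarrow> real^'n"
  assumes [measurable]: "f \<in> borel_measurable M"
  shows "(\<lambda>x. vec_floor (f x)) \<in> borel_measurable M"
proof -
  have "(\<lambda>x. vec_floor (f x)) = (\<lambda>x. \<Sum>i\<in>UNIV. of_int \<lfloor>f x $ i\<rfloor> *\<^sub>R axis i 1)"
    by (subst vec_eq_sum_axis) simp
  then show ?thesis by simp
qed

section \<open>Lebesgue measure under translations, dilations and exchange of integrals\<close>

lemma nn_integral_lborel_shift:
  fixes f :: "'a::euclidean_space \<Rightarrow> ennreal"
  assumes [measurable]: "f \<in> borel_measurable borel"
  shows "(\<integral>\<^sup>+x. f (x + a) \<partial>lborel) = (\<integral>\<^sup>+x. f x \<partial>lborel)"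
proof -
  have "(\<integral>\<^sup>+x. f x \<partial>lborel) = (\<integral>\<^sup>+x. f x \<partial>distr lborel borel ((+) a))"
    by (simp add: lborel_distr_plus)
  also have "\<dots> = (\<integral>\<^sup>+x. f (x + a) \<partial>lborel)"
    by (subst nn_integral_distr) (auto simp: add.commute)
  finally show ?thesis by simp
qed

lemma nn_integral_lborel_scale:
  fixes f :: "real^'n \<Rightarrow> ennreal"
  assumes [measurable]: "f \<in> borel_measurable borel" and "0 < w"
  shows "ennreal (w ^ CARD('n)) * (\<integral>\<^sup>+x. f (w *\<^sub>R x) \<partial>lborel) = (\<integral>\<^sup>+x. f x \<partial>lborel)"
proof -
  have "(\<integral>\<^sup>+x. f x \<partial>lborel) = (\<integral>\<^sup>+x. f x \<partial>density (distr lborel borel (\<lambda>x. 0 + w *\<^sub>R x)) (\<lambda>_. \<bar>w\<bar>^DIM(real^'n)))"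
    using \<open>0 < w\<close> by (subst lborel_affine[of w 0]) auto
  also have "\<dots> = ennreal (w ^ CARD('n)) * (\<integral>\<^sup>+x. f (w *\<^sub>R x) \<partial>lborel)"
    using \<open>0 < w\<close> by (simp add: nn_integral_density nn_integral_distr nn_integral_cmult)
  finally show ?thesis by simp
qed

lemma nn_integral_swap:
  fixes f :: "'a::euclidean_space \<Rightarrow> 'b::euclidean_space \<Rightarrow> ennreal"
  assumes "case_prod f \<in> borel_measurable (borel \<Otimes>\<^sub>M borel)"
  shows "(\<integral>\<^sup>+x. \<integral>\<^sup>+y. f x y \<partial>lborel \<partial>lborel) = (\<integral>\<^sup>+y. \<integral>\<^sup>+x. f x y \<partial>lborel \<partial>lborel)"
  by (rule lborel_pair.Fubini'[symmetric]) (use assms in \<open>simp add: split_beta' cong: measurable_cong_sets\<close>)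

lemma nn_integral_vupd:
  fixes f :: "real^'n \<Rightarrow> ennreal"
  assumes [measurable]: "f \<in> borel_measurable borel"
  shows "(\<integral>\<^sup>+s. f (vupd y i s) \<partial>lborel) = (\<integral>\<^sup>+s. f (y + s *\<^sub>R axis i 1) \<partial>lborel)"
  unfolding vupd_eq
  using nn_integral_lborel_shift[of "\<lambda>s. f (y + s *\<^sub>R axis i 1)" "- y $ i"] by simp

text \<open>Fubini without splitting off coordinate \<open>i\<close>: the indicator of a null set,
  integrated over all \<open>y\<close> and all shifts along the axis, gives 0 because each translate
  of the set is null.\<close>

lemma AE_vupd:
  fixes Q :: "real^'n \<Rightarrow> bool"
  assumes "AE y in lborel. Q y"
  shows "AE y in lborel. AE t in lborel. Q (vupd y i t)"
proof -
  obtain N where N: "{y. \<not> Q y} \<subseteq> N" "emeasure lborel N = 0" and [measurable]: "N \<in> sets borel"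
    using assms by (auto elim!: AE_E)
  have "(\<integral>\<^sup>+y. \<integral>\<^sup>+s. indicator N (y + s *\<^sub>R axis i 1) \<partial>lborel \<partial>lborel)
     = (\<integral>\<^sup>+s. \<integral>\<^sup>+y. indicator N (y + s *\<^sub>R axis i 1) \<partial>(lborel::(real^'n) measure) \<partial>lborel)"
    by (rule nn_integral_swap) measurable
  also have "\<dots> = 0"
    using N(2) by (subst nn_integral_lborel_shift) auto
  finally have "AE y in (lborel::(real^'n) measure). (\<integral>\<^sup>+s. indicator N (y + s *\<^sub>R axis i 1) \<partial>lborel) = 0"
    by (subst (asm) nn_integral_0_iff_AE) auto
  then show ?thesis
  proof eventually_elim
    case (elim y)
    then have "(\<integral>\<^sup>+s. indicator N (vupd y i s) \<partial>lborel) = 0"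
      by (subst nn_integral_vupd) auto
    then have "AE s in lborel. indicator N (vupd y i s) = (0::ennreal)"
      by (subst (asm) nn_integral_0_iff_AE) auto
    then show ?case by eventually_elim (use N(1) in \<open>auto simp: indicator_def split: if_splits\<close>)
  qed
qed

section \<open>Mixed norms\<close>

text \<open>Functions of fewer variables are kept as functions on the whole space; the predicate
  records which coordinates still matter once the others have been integrated out.\<close>

definition depends_only :: "'n set \<Rightarrow> (real^'n \<Rightarrow> 'b) \<Rightarrow> bool" where
  "depends_only S f \<longleftrightarrow> (\<forall>x y. (\<forall>j\<in>S. x $ j = y $ j) \<longrightarrow> f x = f y)"

definition coord_norm :: "real \<Rightarrow> 'n::finite \<Rightarrow> (real^'n \<Rightarrow> ennreal) \<Rightarrow> real^'n \<Rightarrow> ennreal" where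
  "coord_norm p i g y = epowr (\<integral>\<^sup>+t. epowr (g (vupd y i t)) p \<partial>lborel) (1 / p)"

lemma mixnorm_aux_Cons: "mixnorm_aux (i # is) P g = mixnorm_aux is P (coord_norm (P i) i g)"
  by (simp add: coord_norm_def[abs_def] fun_eq_iff)

lemma borel_measurable_coord_norm [measurable]:
  assumes [measurable]: "g \<in> borel_measurable borel"
  shows "coord_norm p i g \<in> borel_measurable borel"
  unfolding coord_norm_def by measurable

lemma depends_only_vupd:
  assumes "depends_only S f"
  shows "depends_only (S - {i}) (\<lambda>y. F (\<lambda>t. f (vupd y i t)))"
  unfolding depends_only_def
proof (intro allI impI)
  fix x y :: "real^'a" assume "\<forall>j\<in>S - {i}. x $ j = y $ j"
  then have "f (vupd x i t) = f (vupd y i t)" for t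
    using assms by (auto simp: depends_only_def vupd_nth)
  then show "F (\<lambda>t. f (vupd x i t)) = F (\<lambda>t. f (vupd y i t))" by simp
qed

lemma depends_only_mixnorm_aux:
  "depends_only S g \<Longrightarrow> depends_only (S - set is) (mixnorm_aux is P g)"
proof (induction "is" arbitrary: S g)
  case (Cons i "is")
  have "depends_only (S - {i}) (coord_norm (P i) i g)"
    using depends_only_vupd[OF Cons.prems, of i "\<lambda>h. epowr (\<integral>\<^sup>+t. epowr (h t) (P i) \<partial>lborel) (1 / P i)"]
    by (simp add: coord_norm_def[abs_def])
  from Cons.IH[OF this] show ?case
    by (simp add: mixnorm_aux_Cons Diff_insert2[symmetric] Diff_insert[symmetric] insert_commute del: mixnorm_aux.simps)
qed (simp add: depends_only_def)

text \<open>With no coordinate left, the base point is irrelevant. Hence a statement about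
  \<open>mixnorm_aux\<close> at almost every point is a statement at the single point 0 used in
  \<open>mixed_norm\<close>.\<close>

lemma mixnorm_aux_const:
  assumes "set is = UNIV"
  shows "mixnorm_aux is P g x = mixnorm_aux is P g y"
proof -
  have "depends_only UNIV g" by (simp add: depends_only_def flip: vec_eq_iff)
  from depends_only_mixnorm_aux[OF this, of "is" P] show ?thesis
    using assms by (simp add: depends_only_def)
qed

lemma coord_norm_mono: "1 \<le> p \<Longrightarrow> (AE t in lborel. g (vupd y i t) \<le> h (vupd y i t)) \<Longrightarrow> coord_norm p i g y \<le> coord_norm p i h y"
  unfolding coord_norm_def
  by (intro epowr_mono nn_integral_mono_AE) (auto elim!: eventually_mono intro: epowr_mono)

lemma AE_lborel_const: "(AE x in (lborel :: (real^'n::finite) measure). Q) \<longleftrightarrow> Q"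
proof -
  have "ae_filter (lborel :: (real^'n) measure) \<noteq> bot"
    by (simp add: ae_filter_eq_bot_iff)
  then show ?thesis by (rule eventually_const)
qed

lemma coord_norm_cmult:
  assumes [measurable]: "g \<in> borel_measurable borel" and "1 \<le> p"
  shows "coord_norm p i (\<lambda>x. c * g x) y = c * coord_norm p i g y"
  using assms(2) by (simp add: coord_norm_def epowr_mult nn_integral_cmult epowr_epowr)

text \<open>The shares a/(a+b) and b/(a+b) sum to 1, and a number in [0,1] only grows when raised to
  a power r \<le> 1.\<close>

lemma powr_add_le:
  fixes a b r :: real
  assumes "0 \<le> a" "0 \<le> b" "0 < r" "r \<le> 1"
  shows "(a + b) powr r \<le> a powr r + b powr r"
proof (cases "a + b = 0")
  case False
  have *: "c / (a + b) \<le> (c / (a + b)) powr r" if "0 \<le> c" "c \<le> a + b" for c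
    using that assms powr_mono'[of r 1 "c / (a + b)"] by (cases "c = 0") auto
  have "1 = a / (a + b) + b / (a + b)" using False by (simp flip: add_divide_distrib)
  also have "\<dots> \<le> (a / (a + b)) powr r + (b / (a + b)) powr r"
    using assms by (intro add_mono *) auto
  also have "\<dots> = (a powr r + b powr r) / (a + b) powr r"
    using assms by (simp add: powr_divide add_divide_distrib)
  finally show ?thesis using assms False by (simp add: field_simps)
qed (use assms in auto)

lemma epowr_add_le:
  assumes "1 \<le> p"
  shows "epowr (x + y) (1 / p) \<le> epowr x (1/p) + epowr y (1/p)"
proof (cases x; cases y)
  fix a b assume *: "0 \<le> a" "x = ennreal a" "0 \<le> b" "y = ennreal b"
  have "(a + b) powr (1/p) \<le> a powr (1/p) + b powr (1/p)"
    using * assms by (intro powr_add_le) auto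
  then show ?thesis
    using * by (simp add: epowr_ennreal ennreal_leI flip: ennreal_plus)
qed auto

lemma epowr_add_le2:
  assumes "0 < p"
  shows "epowr (x + y) p \<le> epowr 2 p * (epowr x p + epowr y p)"
proof -
  have "epowr (x + y) p \<le> epowr (2 * max x y) p"
    using assms by (intro epowr_mono) (auto simp: mult_2 intro: add_mono)
  also have "\<dots> = epowr 2 p * epowr (max x y) p" by (rule epowr_mult)
  also have "epowr (max x y) p \<le> epowr x p + epowr y p"
    by (auto simp: max_def)
  finally show ?thesis by (simp add: mult_left_mono)
qed

text \<open>A cheap substitute for Minkowski's inequality: x + y \<le> 2 max(x, y) inside the
  integral, subadditivity of the power 1/p outside. The factor 2 per coordinate is harmless because
  only limits equal to 0 are drawn from it.\<close>

lemma coord_norm_add: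
  assumes [measurable]: "g \<in> borel_measurable borel" "h \<in> borel_measurable borel" and p: "1 \<le> p"
  shows "coord_norm p i (\<lambda>x. g x + h x) y \<le> 2 * (coord_norm p i g y + coord_norm p i h y)"
proof -
  have "coord_norm p i (\<lambda>x. g x + h x) y
    \<le> epowr (\<integral>\<^sup>+t. epowr 2 p * (epowr (g (vupd y i t)) p + epowr (h (vupd y i t)) p) \<partial>lborel) (1/p)"
    unfolding coord_norm_def using p by (intro epowr_mono nn_integral_mono epowr_add_le2) auto
  also have "\<dots> = 2 * epowr ((\<integral>\<^sup>+t. epowr (g (vupd y i t)) p \<partial>lborel) + (\<integral>\<^sup>+t. epowr (h (vupd y i t)) p \<partial>lborel)) (1/p)"
    using p by (simp add: nn_integral_cmult nn_integral_add epowr_mult epowr_epowr)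
  also have "\<dots> \<le> 2 * (coord_norm p i g y + coord_norm p i h y)"
    unfolding coord_norm_def by (intro mult_left_mono epowr_add_le p) auto
  finally show ?thesis .
qed

context
  fixes P :: "'n::finite \<Rightarrow> real"
  assumes P: "\<And>i. 1 \<le> P i"
begin

lemma exponent_pos: "0 < P i"
  using P[of i] by linarith

lemma mixnorm_aux_mono: "(\<And>x. g x \<le> h x) \<Longrightarrow> mixnorm_aux is P g x \<le> mixnorm_aux is P h x"
proof (induction "is" arbitrary: g h)
  case (Cons i "is")
  then show ?case unfolding mixnorm_aux_Cons by (intro Cons.IH coord_norm_mono P) auto
qed simp

lemma mixnorm_aux_mono_AE_aux:
  "AE x in lborel. g x \<le> h x \<Longrightarrow> AE x in lborel. mixnorm_aux is P g x \<le> mixnorm_aux is P h x"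
proof (induction "is" arbitrary: g h)
  case (Cons i "is")
  have "AE y in lborel. coord_norm (P i) i g y \<le> coord_norm (P i) i h y"
    using AE_vupd[OF Cons.prems, of i] by eventually_elim (auto intro: coord_norm_mono P)
  from Cons.IH[OF this] show ?case unfolding mixnorm_aux_Cons .
qed simp

text \<open>The induction yields the inequality at almost every base point, and both sides are
  constant in the base point. Neither function is assumed measurable, so Lebesgue measurable
  functions are admissible.\<close>

lemma mixnorm_aux_mono_AE:
  assumes "set is = UNIV" "AE x in lborel. g x \<le> h x"
  shows "mixnorm_aux is P g x \<le> mixnorm_aux is P h x"
proof -
  have "AE y in (lborel :: (real^'n) measure). mixnorm_aux is P g x \<le> mixnorm_aux is P h x"
    using mixnorm_aux_mono_AE_aux[OF assms(2), of "is"]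
  proof eventually_elim
    case (elim y)
    then show ?case by (simp only: mixnorm_aux_const[OF assms(1), of P _ x y])
  qed
  then show ?thesis by (simp only: AE_lborel_const)
qed

lemma mixnorm_aux_cmult:
  assumes "g \<in> borel_measurable borel"
  shows "mixnorm_aux is P (\<lambda>x. c * g x) x = c * mixnorm_aux is P g x"
  using assms
proof (induction "is" arbitrary: g)
  case (Cons i "is")
  note [measurable] = Cons.prems
  have "coord_norm (P i) i (\<lambda>x. c * g x) = (\<lambda>y. c * coord_norm (P i) i g y)"
    by (intro ext coord_norm_cmult P) measurable
  then show ?case unfolding mixnorm_aux_Cons by (simp add: Cons.IH)
qed simp

lemma mixnorm_aux_add:
  assumes "g \<in> borel_measurable borel" "h \<in> borel_measurable borel"
  shows "mixnorm_aux is P (\<lambda>x. g x + h x) x \<le> 2 ^ length is * (mixnorm_aux is P g x + mixnorm_aux is P h x)"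
  using assms
proof (induction "is" arbitrary: g h)
  case (Cons i "is")
  note [measurable] = Cons.prems
  have "mixnorm_aux (i # is) P (\<lambda>x. g x + h x) x
    \<le> mixnorm_aux is P (\<lambda>y. 2 * (coord_norm (P i) i g y + coord_norm (P i) i h y)) x"
    unfolding mixnorm_aux_Cons by (intro mixnorm_aux_mono coord_norm_add P) auto
  also have "\<dots> = 2 * mixnorm_aux is P (\<lambda>y. coord_norm (P i) i g y + coord_norm (P i) i h y) x"
    by (intro mixnorm_aux_cmult) measurable
  also have "\<dots> \<le> 2 * (2 ^ length is * (mixnorm_aux (i # is) P g x + mixnorm_aux (i # is) P h x))"
    unfolding mixnorm_aux_Cons by (intro mult_left_mono Cons.IH) auto
  finally show ?case by (simp add: mult.assoc del: mixnorm_aux.simps)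
qed simp

text \<open>The factor depends only on \<open>w\<close> and the exponents, so it cancels when both
  sides of an estimate are dilated.\<close>

lemma mixnorm_aux_scale:
  assumes "0 < w" "g \<in> borel_measurable borel"
  shows "mixnorm_aux is P (\<lambda>x. g (w *\<^sub>R x)) x = (\<Prod>i\<leftarrow>is. ennreal (w powr (- 1 / P i))) * mixnorm_aux is P g (w *\<^sub>R x)"
  using assms(2)
proof (induction "is" arbitrary: g)
  case (Cons i "is")
  note [measurable] = Cons.prems
  have "coord_norm (P i) i (\<lambda>x. g (w *\<^sub>R x)) y = ennreal (w powr (- 1 / P i)) * coord_norm (P i) i g (w *\<^sub>R y)" for y
  proof -
    have v: "w *\<^sub>R vupd y i t = vupd (w *\<^sub>R y) i (w * t)" for t
      by (simp add: vec_eq_iff vupd_nth)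
    define J where "J = (\<integral>\<^sup>+t. epowr (g (vupd (w *\<^sub>R y) i (w * t))) (P i) \<partial>lborel)"
    have "(\<integral>\<^sup>+t. epowr (g (vupd (w *\<^sub>R y) i t)) (P i) \<partial>lborel) = ennreal w * J"
      unfolding J_def using \<open>0 < w\<close> by (subst nn_integral_real_affine[where c=w and t=0]) auto
    moreover have "epowr (ennreal w) (1 / P i) = ennreal (w powr (1 / P i))"
      using \<open>0 < w\<close> by (simp add: epowr_ennreal)
    moreover have "ennreal (w powr (- 1 / P i)) * (ennreal (w powr (1 / P i)) * z) = z" for z
      using \<open>0 < w\<close> by (simp add: mult.assoc[symmetric] powr_minus flip: ennreal_mult)
    ultimately show ?thesis
      by (simp add: coord_norm_def v epowr_mult J_def[symmetric])
  qed
  then have "coord_norm (P i) i (\<lambda>x. g (w *\<^sub>R x)) = (\<lambda>y. ennreal (w powr (- 1 / P i)) * coord_norm (P i) i g (w *\<^sub>R y))"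
    by (rule ext)
  then have "mixnorm_aux (i # is) P (\<lambda>x. g (w *\<^sub>R x)) x = ennreal (w powr (- 1 / P i)) * mixnorm_aux is P (\<lambda>y. coord_norm (P i) i g (w *\<^sub>R y)) x"
    unfolding mixnorm_aux_Cons by (simp add: mixnorm_aux_cmult)
  then show ?case
    unfolding mixnorm_aux_Cons by (subst (asm) Cons.IH) (auto simp: mult.assoc)
qed simp

text \<open>Dominated convergence in one coordinate at a time. Finiteness of the norm of
  \<open>H\<close> gives finiteness of \<open>H\<close> only almost everywhere on a line, so
  convergence is claimed only where \<open>H\<close> is finite; this conditional form is what passes
  through the induction.\<close>

lemma mixnorm_aux_dominated_AE:
  fixes h :: "nat \<Rightarrow> real^'n \<Rightarrow> ennreal"
  assumes "\<And>m. h m \<in> borel_measurable borel" "H \<in> borel_measurable borel"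
    and "\<And>m x. h m x \<le> H x"
    and "AE x in lborel. H x < top \<longrightarrow> (\<lambda>m. h m x) \<longlonglongrightarrow> 0"
  shows "AE x in lborel. mixnorm_aux is P H x < top \<longrightarrow> (\<lambda>m. mixnorm_aux is P (h m) x) \<longlonglongrightarrow> 0"
  using assms
proof (induction "is" arbitrary: h H)
  case (Cons i "is")
  note [measurable] = Cons.prems(1,2)
  have "AE y in lborel. coord_norm (P i) i H y < top \<longrightarrow> (\<lambda>m. coord_norm (P i) i (h m) y) \<longlonglongrightarrow> 0"
    using AE_vupd[OF Cons.prems(4), of i]
  proof eventually_elim
    case (elim y)
    show ?case
    proof
      assume "coord_norm (P i) i H y < top"
      then have fin: "(\<integral>\<^sup>+t. epowr (H (vupd y i t)) (P i) \<partial>lborel) < top"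
        by (simp add: coord_norm_def)
      then have "AE t in lborel. epowr (H (vupd y i t)) (P i) \<noteq> top"
        by (intro nn_integral_noteq_infinite[unfolded infinity_ennreal_def]) auto
      then have fin': "AE t in lborel. H (vupd y i t) < top"
        by eventually_elim (metis epowr_less_top_iff top.not_eq_extremum)
      have "(\<lambda>m. \<integral>\<^sup>+t. epowr (h m (vupd y i t)) (P i) \<partial>lborel) \<longlonglongrightarrow> (\<integral>\<^sup>+t. 0 \<partial>(lborel::real measure))"
      proof (rule nn_integral_dominated_convergence[where w="\<lambda>t. epowr (H (vupd y i t)) (P i)"])
        show "AE t in lborel. (\<lambda>m. epowr (h m (vupd y i t)) (P i)) \<longlonglongrightarrow> 0"
          using elim fin' by eventually_elim (auto intro: tendsto_epowr_0 exponent_pos)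
      qed (use fin Cons.prems(3) exponent_pos[of i] in \<open>auto intro!: epowr_mono simp: less_imp_le\<close>)
      then show "(\<lambda>m. coord_norm (P i) i (h m) y) \<longlonglongrightarrow> 0"
        unfolding coord_norm_def using exponent_pos[of i] by (intro tendsto_epowr_0) auto
    qed
  qed
  then show ?case unfolding mixnorm_aux_Cons
    by (intro Cons.IH) (auto intro!: coord_norm_mono P Cons.prems(3))
qed simp

lemma mixnorm_aux_dominated:
  fixes h :: "nat \<Rightarrow> real^'n \<Rightarrow> ennreal"
  assumes "\<And>m. h m \<in> borel_measurable borel" "H \<in> borel_measurable borel"
    and "\<And>m x. h m x \<le> H x"
    and "AE x in lborel. (\<lambda>m. h m x) \<longlonglongrightarrow> 0"
    and "set is = UNIV" "mixnorm_aux is P H x < top"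
  shows "(\<lambda>m. mixnorm_aux is P (h m) x) \<longlonglongrightarrow> 0"
proof -
  have "AE y in lborel. H y < top \<longrightarrow> (\<lambda>m. h m y) \<longlonglongrightarrow> 0"
    using assms(4) by eventually_elim simp
  from mixnorm_aux_dominated_AE[OF assms(1-3) this, of "is"]
  have "AE y in (lborel :: (real^'n) measure). (\<lambda>m. mixnorm_aux is P (h m) x) \<longlonglongrightarrow> 0"
  proof eventually_elim
    case (elim y)
    then show ?case using assms(6) by (simp only: mixnorm_aux_const[OF assms(5), of P _ x y])
  qed
  then show ?thesis by (simp only: AE_lborel_const)
qed

text \<open>Integrating over an interval of length 2L replaces the bound \<open>C\<close> by a new
  constant. The vanishing condition concerns only the coordinates still in the list, so it survives
  each step.\<close>

lemma mixnorm_aux_finite: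
  assumes "distinct is" "0 \<le> C" "0 \<le> L" "\<And>x. g x \<le> ennreal C" "\<And>x i. i \<in> set is \<Longrightarrow> L < \<bar>x $ i\<bar> \<Longrightarrow> g x = 0"
  shows "mixnorm_aux is P g x < top"
  using assms
proof (induction "is" arbitrary: g C)
  case Nil
  then show ?case using order.strict_trans1[OF Nil(4)[of x] ennreal_less_top] by simp
next
  case (Cons i "is")
  define C' where "C' = (C powr P i * (2 * L)) powr (1 / P i)"
  have bd: "coord_norm (P i) i g y \<le> ennreal C'" for y
  proof -
    have "(\<integral>\<^sup>+t. epowr (g (vupd y i t)) (P i) \<partial>lborel) \<le> (\<integral>\<^sup>+t. ennreal (C powr P i) * indicator {-L..L} t \<partial>lborel)"
    proof (rule nn_integral_mono)
      fix t
      have "epowr (g (vupd y i t)) (P i) \<le> epowr (ennreal C) (P i)"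
        using exponent_pos[of i] Cons.prems by (intro epowr_mono) auto
      moreover have "g (vupd y i t) = 0" if "t \<notin> {-L..L}"
        by (rule Cons.prems(5)[of i]) (use that in \<open>auto simp: vupd_nth\<close>)
      ultimately show "epowr (g (vupd y i t)) (P i) \<le> ennreal (C powr P i) * indicator {-L..L} t"
        using Cons.prems by (auto simp: epowr_ennreal indicator_def)
    qed
    also have "\<dots> = ennreal (C powr P i * (2 * L))"
      using Cons.prems by (simp add: nn_integral_cmult_indicator ennreal_mult)
    finally have "coord_norm (P i) i g y \<le> epowr (ennreal (C powr P i * (2 * L))) (1 / P i)"
      unfolding coord_norm_def using exponent_pos[of i] by (intro epowr_mono) auto
    then show ?thesis using Cons.prems by (simp add: C'_def epowr_ennreal)
  qed
  moreover have "coord_norm (P i) i g y = 0" if "j \<in> set is" "L < \<bar>y $ j\<bar>" for y j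
  proof -
    have "j \<noteq> i" using that Cons.prems by auto
    then have "g (vupd y i t) = 0" for t
      using that by (intro Cons.prems(5)[of j]) (auto simp: vupd_nth)
    then show ?thesis by (simp add: coord_norm_def)
  qed
  moreover have "0 \<le> C'" by (simp add: C'_def)
  ultimately show ?case using Cons.prems(1,3) unfolding mixnorm_aux_Cons by (intro Cons.IH) auto
qed

end

section \<open>Jensen's inequality and integration over strips\<close>

text \<open>The convex function y^r lies above its tangent at \<open>c\<close>; the negative term is
  moved to the right because \<open>ennreal\<close> has only truncated subtraction.\<close>

lemma Young_tangent_ennreal:
  assumes "1 \<le> r" "0 < c"
  shows "ennreal (r * c powr (r - 1)) * y \<le> epowr y r + ennreal ((r - 1) * c powr r)"
proof (cases "y = 0 \<or> y = top")
  case True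
  then show ?thesis by auto
next
  case False
  then obtain z where real: "0 < z" "y = ennreal z"
    by (cases y) (auto simp: less_le)
  \<comment> \<open>Young's inequality for z^r and c^r with weights 1/r and 1 - 1/r; multiplication
    by r then gives the tangent inequality.\<close>
  have "(z powr r) powr (1 / r) * (c powr r) powr (1 - 1 / r) \<le> 1 / r * z powr r + (1 - 1 / r) * c powr r"
    using assms real by (intro Youngs_inequality_0) auto
  moreover have "(z powr r) powr (1 / r) = z" using real assms by (simp add: powr_powr)
  moreover have "r * (1 - 1 / r) = r - 1" using assms by (simp add: field_simps)
  then have "(c powr r) powr (1 - 1 / r) = c powr (r - 1)" by (simp add: powr_powr)
  ultimately have "z * c powr (r - 1) \<le> 1 / r * z powr r + (1 - 1 / r) * c powr r" by simp
  then have "r * (z * c powr (r - 1)) \<le> r * (1 / r * z powr r + (1 - 1 / r) * c powr r)"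
    using assms by (intro mult_left_mono) auto
  also have "\<dots> = z powr r + (r - 1) * c powr r"
    using assms by (simp add: field_simps)
  finally show ?thesis
    using real assms by (simp add: epowr_ennreal mult_ac flip: ennreal_mult ennreal_plus)
qed

text \<open>The tangent inequality is integrated against the weight \<open>k\<close> and the point
  of tangency is optimized. A weight of mass at most \<open>M\<close> suffices, without
  normalization.\<close>

lemma nn_integral_Jensen_powr:
  assumes [measurable]: "k \<in> borel_measurable N" "g \<in> borel_measurable N"
    and k: "(\<integral>\<^sup>+x. k x \<partial>N) \<le> ennreal M" and "0 < M" "1 \<le> r"
  shows "epowr (\<integral>\<^sup>+x. k x * g x \<partial>N) r \<le> ennreal (M powr (r - 1)) * (\<integral>\<^sup>+x. k x * epowr (g x) r \<partial>N)"
proof -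
  define A where "A = (\<integral>\<^sup>+x. k x * g x \<partial>N)"
  define J where "J = (\<integral>\<^sup>+x. k x * epowr (g x) r \<partial>N)"
  have tangent: "ennreal (r * c powr (r - 1)) * A \<le> J + ennreal ((r - 1) * c powr r * M)" if "0 < c" for c
  proof -
    have "ennreal (r * c powr (r - 1)) * A = (\<integral>\<^sup>+x. k x * (ennreal (r * c powr (r - 1)) * g x) \<partial>N)"
      unfolding A_def by (subst nn_integral_cmult[symmetric]) (auto simp: mult_ac)
    also have "\<dots> \<le> (\<integral>\<^sup>+x. k x * epowr (g x) r + ennreal ((r - 1) * c powr r) * k x \<partial>N)"
      using Young_tangent_ennreal[OF \<open>1 \<le> r\<close> that]
      by (intro nn_integral_mono) (auto simp: distrib_left[symmetric] mult.commute[of _ "k _"] intro!: mult_left_mono)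
    also have "\<dots> = J + ennreal ((r - 1) * c powr r) * (\<integral>\<^sup>+x. k x \<partial>N)"
      unfolding J_def by (simp add: nn_integral_add nn_integral_cmult)
    also have "\<dots> \<le> J + ennreal ((r - 1) * c powr r) * ennreal M"
      by (intro add_left_mono mult_left_mono k) auto
    finally show ?thesis using \<open>1 \<le> r\<close> \<open>0 < M\<close> by (simp add: ennreal_mult)
  qed
  have "epowr A r \<le> ennreal (M powr (r - 1)) * J"
  proof (cases A)
    case (real a)
    show ?thesis
    proof (cases "a = 0 \<or> J = top")
      case True
      then show ?thesis using real \<open>0 < M\<close> by (auto simp: ennreal_mult_top)
    next
      case False
      then obtain j where j: "J = ennreal j" "0 \<le> j" by (cases J) auto
      have a: "0 < a" using real False by auto
      \<comment> \<open>The mean of \<open>g\<close> for a weight of mass exactly \<open>M\<close>.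
        At this point \<open>tangent\<close> reduces to c^r M \<le> J, which is the claim divided by
        M^(r-1).\<close>
      define c where "c = a / M"
      have c: "0 < c" "a = c * M" using a \<open>0 < M\<close> by (auto simp: c_def)
      have "r * c powr (r - 1) * a \<le> j + (r - 1) * c powr r * M"
        using tangent[OF c(1)] real j \<open>1 \<le> r\<close> \<open>0 < M\<close>
        by (simp flip: ennreal_mult ennreal_plus add: mult_nonneg_nonneg)
      moreover have "c powr r = c powr (r - 1) * c"
        using c by (metis powr_mult_base mult.commute add.commute diff_add_cancel less_imp_le)
      ultimately have "c powr r * M \<le> j"
        using c by (simp add: algebra_simps)
      then have "M powr (r - 1) * (c powr r * M) \<le> M powr (r - 1) * j"
        by (intro mult_left_mono) auto
      moreover have "M powr (r - 1) * (c powr r * M) = a powr r"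
      proof -
        have "M powr r = M powr (r - 1) * M"
          using \<open>0 < M\<close> by (metis powr_mult_base mult.commute add.commute diff_add_cancel less_imp_le)
        then show ?thesis using c \<open>0 < M\<close> by (simp add: powr_mult)
      qed
      ultimately show ?thesis using real j by (simp add: epowr_ennreal flip: ennreal_mult)
    qed
  next
    case top
    then have "J = top" using tangent[of 1] \<open>1 \<le> r\<close> by (auto simp: ennreal_mult_top top_unique)
    then show ?thesis using \<open>0 < M\<close> by (simp add: ennreal_mult_top)
  qed
  then show ?thesis by (simp add: A_def J_def)
qed

text \<open>A coordinate outside \<open>S\<close> is confined to [0,1) and so contributes a factor
  1: for a function that depends only on the coordinates in \<open>S\<close>, the integral over the
  strip is the integral over those coordinates alone.\<close>

definition strip :: "'n set \<Rightarrow> (real^'n) set" where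
  "strip S = {t. \<forall>j. j \<notin> S \<longrightarrow> \<lfloor>t $ j\<rfloor> = 0}"

lemma sets_strip [measurable]: "strip S \<in> sets borel"
proof -
  have "strip S = (\<Inter>j\<in>-S. {t \<in> space borel. \<lfloor>t $ j\<rfloor> = 0})"
    by (auto simp: strip_def)
  also have "\<dots> \<in> sets borel"
    by (cases "S = UNIV") (auto intro!: sets.countable_INT'')
  finally show ?thesis .
qed

text \<open>Sliding the smaller strip along axis \<open>i\<close> covers each point of the larger
  one for a set of shifts of length exactly 1, so Fubini and translation invariance suffice.\<close>

lemma nn_integral_strip:
  fixes G :: "real^'n \<Rightarrow> ennreal"
  assumes [measurable]: "G \<in> borel_measurable borel" and "i \<in> S"
  shows "(\<integral>\<^sup>+t. indicator (strip S) t * G t \<partial>lborel)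
       = (\<integral>\<^sup>+t. indicator (strip (S - {i})) t * (\<integral>\<^sup>+s. G (vupd t i s) \<partial>lborel) \<partial>lborel)"
proof -
  let ?e = "axis i 1 :: real^'n"
  have *: "(\<integral>\<^sup>+s. indicator (strip (S - {i})) (t - s *\<^sub>R ?e) \<partial>lborel) = (indicator (strip S) t :: ennreal)" for t
  proof -
    have "\<lfloor>t $ i - s\<rfloor> = 0 \<longleftrightarrow> s \<in> {t $ i - 1<..t $ i}" for s
      by (auto simp: floor_eq_iff)
    then have "(indicator (strip (S - {i})) (t - s *\<^sub>R ?e) :: ennreal) = indicator (strip S) t * indicator {t $ i - 1<..t $ i} s" for s
      using \<open>i \<in> S\<close> by (auto simp: strip_def indicator_def axis_def)
    then show ?thesis by (simp add: nn_integral_cmult)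
  qed
  have "(\<integral>\<^sup>+t. indicator (strip (S - {i})) t * (\<integral>\<^sup>+s. G (vupd t i s) \<partial>lborel) \<partial>lborel)
      = (\<integral>\<^sup>+t. \<integral>\<^sup>+s. indicator (strip (S - {i})) t * G (t + s *\<^sub>R ?e) \<partial>lborel \<partial>lborel)"
    by (subst nn_integral_vupd) (auto simp: nn_integral_cmult)
  also have "\<dots> = (\<integral>\<^sup>+s. \<integral>\<^sup>+t. indicator (strip (S - {i})) t * G (t + s *\<^sub>R ?e) \<partial>lborel \<partial>lborel)"
    by (rule nn_integral_swap) measurable
  also have "\<dots> = (\<integral>\<^sup>+s. \<integral>\<^sup>+t. indicator (strip (S - {i})) (t - s *\<^sub>R ?e) * G t \<partial>lborel \<partial>lborel)"
  proof (rule nn_integral_cong)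
    fix s :: real
    show "(\<integral>\<^sup>+t. indicator (strip (S - {i})) t * G (t + s *\<^sub>R ?e) \<partial>lborel)
        = (\<integral>\<^sup>+t. indicator (strip (S - {i})) (t - s *\<^sub>R ?e) * G t \<partial>lborel)"
      using nn_integral_lborel_shift[of "\<lambda>t. indicator (strip (S - {i})) (t - s *\<^sub>R ?e) * G t" "s *\<^sub>R ?e"]
      by simp
  qed
  also have "\<dots> = (\<integral>\<^sup>+t. \<integral>\<^sup>+s. indicator (strip (S - {i})) (t - s *\<^sub>R ?e) * G t \<partial>lborel \<partial>lborel)"
    by (rule nn_integral_swap) measurable
  also have "\<dots> = (\<integral>\<^sup>+t. indicator (strip S) t * G t \<partial>lborel)"
    by (subst nn_integral_multc) (auto simp: *)
  finally show ?thesis by simp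
qed

text \<open>The inner integral is the sum of \<open>h\<close> over all integer translates of
  \<open>r\<close>. For fixed \<open>s\<close>, the \<open>u\<close> that bring s +
  \<lfloor>u\<rfloor> into [0,1) fill one unit interval, so exchanging the integrals returns the
  integral of \<open>h\<close>.\<close>

lemma nn_integral_periodize_real:
  fixes h :: "real \<Rightarrow> ennreal"
  assumes [measurable]: "h \<in> borel_measurable borel"
  shows "(\<integral>\<^sup>+s. h s \<partial>lborel) = (\<integral>\<^sup>+r. indicator {0..<1} r * (\<integral>\<^sup>+u. h (r - of_int \<lfloor>u::real\<rfloor>) \<partial>lborel) \<partial>lborel)"
proof -
  have *: "(\<integral>\<^sup>+u. indicator {0..<1} (s + of_int \<lfloor>u::real\<rfloor>) \<partial>lborel) = (1::ennreal)" for s :: real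
  proof -
    have "s + of_int \<lfloor>u\<rfloor> \<in> {0..<1} \<longleftrightarrow> u \<in> {of_int (- \<lfloor>s\<rfloor>)..<of_int (- \<lfloor>s\<rfloor>) + 1}" for u
    proof -
      have "s + of_int \<lfloor>u\<rfloor> \<in> {0..<1} \<longleftrightarrow> \<lfloor>s + of_int \<lfloor>u\<rfloor>\<rfloor> = 0"
        unfolding floor_eq_iff by auto
      also have "\<dots> \<longleftrightarrow> \<lfloor>u\<rfloor> = - \<lfloor>s\<rfloor>" by auto
      also have "\<dots> \<longleftrightarrow> u \<in> {of_int (- \<lfloor>s\<rfloor>)..<of_int (- \<lfloor>s\<rfloor>) + 1}" by (simp add: floor_eq_iff)
      finally show ?thesis .
    qed
    then have eq: "(\<lambda>u. indicator {0..<1} (s + of_int \<lfloor>u\<rfloor>) :: ennreal) = indicator {real_of_int (- \<lfloor>s\<rfloor>)..<real_of_int (- \<lfloor>s\<rfloor>) + 1}"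
      by (auto simp: indicator_def fun_eq_iff)
    show ?thesis unfolding eq by simp
  qed
  have "(\<integral>\<^sup>+r. indicator {0..<1} r * (\<integral>\<^sup>+u. h (r - of_int \<lfloor>u::real\<rfloor>) \<partial>lborel) \<partial>lborel)
      = (\<integral>\<^sup>+r. \<integral>\<^sup>+u. indicator {0..<1} r * h (r - of_int \<lfloor>u::real\<rfloor>) \<partial>lborel \<partial>lborel)"
    by (simp add: nn_integral_cmult)
  also have "\<dots> = (\<integral>\<^sup>+u. \<integral>\<^sup>+r. indicator {0..<1} r * h (r - of_int \<lfloor>u::real\<rfloor>) \<partial>lborel \<partial>lborel)"
    by (rule nn_integral_swap) measurable
  also have "\<dots> = (\<integral>\<^sup>+u. \<integral>\<^sup>+s. indicator {0..<1} (s + of_int \<lfloor>u::real\<rfloor>) * h s \<partial>lborel \<partial>lborel)"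
  proof (rule nn_integral_cong)
    fix u :: real
    show "(\<integral>\<^sup>+r. indicator {0..<1} r * h (r - of_int \<lfloor>u::real\<rfloor>) \<partial>lborel) = (\<integral>\<^sup>+s. indicator {0..<1} (s + of_int \<lfloor>u::real\<rfloor>) * h s \<partial>lborel)"
      using nn_integral_lborel_shift[of "\<lambda>r. indicator {0..<1} r * h (r - of_int \<lfloor>u\<rfloor>)" "of_int \<lfloor>u\<rfloor>"] by simp
  qed
  also have "\<dots> = (\<integral>\<^sup>+s. \<integral>\<^sup>+u. indicator {0..<1} (s + of_int \<lfloor>u::real\<rfloor>) * h s \<partial>lborel \<partial>lborel)"
    by (rule nn_integral_swap) measurable
  also have "\<dots> = (\<integral>\<^sup>+s. h s \<partial>lborel)"
    by (subst nn_integral_multc) (auto simp: *)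
  finally show ?thesis by simp
qed

lemma sets_vec_floor_eq [measurable]: "{t. vec_floor t = k} \<in> sets borel"
proof -
  have "{t. vec_floor t = k} = vec_floor -` {k} \<inter> space borel" by auto
  also have "\<dots> \<in> sets borel" by (rule measurable_sets[OF borel_measurable_vec_floor]) auto
  finally show ?thesis .
qed

lemma inner_one_Basis: "b \<in> Basis \<Longrightarrow> 1 \<bullet> b = 1" for b :: "real^'n"
  by (auto simp: Basis_vec_def inner_axis)

lemma emeasure_unit_cell:
  fixes k :: "real^'n"
  assumes "k \<in> Zn"
  shows "emeasure lborel {t. vec_floor t = k} = 1"
proof -
  have eq: "vec_floor t = k \<longleftrightarrow> (\<forall>i. k $ i \<le> t $ i \<and> t $ i < k $ i + 1)" for t
  proof -
    have "of_int \<lfloor>t $ i\<rfloor> = k $ i \<longleftrightarrow> k $ i \<le> t $ i \<and> t $ i < k $ i + 1" for i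
    proof -
      obtain m where "k $ i = of_int m" using assms by (auto simp: Zn_def elim!: Ints_cases)
      then show ?thesis by (simp add: floor_eq_iff)
    qed
    then show ?thesis by (simp add: vec_eq_iff)
  qed
  \<comment> \<open>The half-open cell lies between the open and the closed box, both of volume
    1.\<close>
  have vol: "emeasure lborel (cbox k (k + 1)) = 1" "emeasure lborel (box k (k + 1)) = 1"
    by (auto simp: emeasure_lborel_cbox_eq emeasure_lborel_box_eq inner_add_left inner_one_Basis)
  have "emeasure lborel {t. vec_floor t = k} \<le> emeasure lborel (cbox k (k + 1))"
    by (intro emeasure_mono) (auto simp: eq cbox_def Basis_vec_def inner_axis less_imp_le)
  moreover have "emeasure lborel (box k (k + 1)) \<le> emeasure lborel {t. vec_floor t = k}"
    by (intro emeasure_mono) (auto simp: eq box_def Basis_vec_def inner_axis less_imp_le)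
  ultimately show ?thesis using vol by simp
qed

lemma strip_empty: "strip {} = {t. vec_floor t = 0}"
  by (auto simp: strip_def vec_eq_iff)

lemma nn_integral_strip_empty:
  "(\<integral>\<^sup>+t. indicator (strip {}) (t::real^'n) * c \<partial>lborel) = c"
  using emeasure_unit_cell[of "0::real^'n"]
  by (simp add: nn_integral_multc strip_empty[symmetric] Zn_def)

section \<open>The operator bound\<close>

text \<open>For \<open>S = UNIV\<close> this is the lattice sum of X(x - k) times the integral of
  \<open>g\<close> over the cell of k; with g = 1 it is the periodization of
  \<open>X\<close>.\<close>

definition cell_op :: "'n set \<Rightarrow> (real^'n \<Rightarrow> ennreal) \<Rightarrow> (real^'n \<Rightarrow> ennreal) \<Rightarrow> real^'n::finite \<Rightarrow> ennreal" where
  "cell_op S X g x = (\<integral>\<^sup>+t. indicator (strip S) t * X (x - vec_floor t) * g t \<partial>lborel)"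

lemma borel_measurable_cell_op [measurable]:
  assumes [measurable]: "X \<in> borel_measurable borel" "g \<in> borel_measurable borel"
  shows "cell_op S X g \<in> borel_measurable borel"
  unfolding cell_op_def by measurable

lemma borel_measurable_nn_integral_vupd [measurable]:
  fixes X :: "real^'n \<Rightarrow> ennreal"
  assumes [measurable]: "X \<in> borel_measurable borel"
  shows "(\<lambda>y. \<integral>\<^sup>+s. X (vupd y i s) \<partial>lborel) \<in> borel_measurable borel"
  by measurable

lemma vupd_vupd [simp]: "vupd (vupd y i s) i t = vupd y i t"
  by (simp add: vec_eq_iff vupd_nth)

text \<open>Integrating \<open>X\<close> over coordinate \<open>i\<close> of its argument gives the
  marginal, which no longer sees coordinate \<open>i\<close> of \<open>t\<close>. The strip formula
  can therefore integrate \<open>g\<close> alone along that axis.\<close>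

lemma cell_op_integrate_coord:
  fixes X g :: "real^'n \<Rightarrow> ennreal"
  assumes [measurable]: "X \<in> borel_measurable borel" "g \<in> borel_measurable borel" and "i \<in> S"
  shows "(\<integral>\<^sup>+s. cell_op S X g (vupd x i s) \<partial>lborel)
    = cell_op (S - {i}) (\<lambda>y. \<integral>\<^sup>+s. X (vupd y i s) \<partial>lborel) (\<lambda>y. \<integral>\<^sup>+s. g (vupd y i s) \<partial>lborel) x"
proof -
  define X' where "X' = (\<lambda>y. \<integral>\<^sup>+s. X (vupd y i s) \<partial>lborel)"
  have [measurable]: "X' \<in> borel_measurable borel" unfolding X'_def by measurable
  have shift: "(\<integral>\<^sup>+s. X (vupd x i s - vec_floor t) \<partial>lborel) = X' (x - vec_floor t)" for t
  proof -
    have "vupd x i s - vec_floor t = vupd (x - vec_floor t) i (s + - of_int \<lfloor>t $ i\<rfloor>)" for s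
      by (simp add: vec_eq_iff vupd_nth)
    then show ?thesis unfolding X'_def
      using nn_integral_lborel_shift[of "\<lambda>s. X (vupd (x - vec_floor t) i s)" "- of_int \<lfloor>t $ i\<rfloor>"] by simp
  qed
  have X'_floor: "X' (x - vec_floor (vupd t i s)) = X' (x - vec_floor t)" for t s
  proof -
    have "vupd (x - vec_floor (vupd t i s)) i r = vupd (x - vec_floor t) i r" for r
      by (simp add: vec_eq_iff vupd_nth)
    then show ?thesis by (simp add: X'_def)
  qed
  have "(\<integral>\<^sup>+s. cell_op S X g (vupd x i s) \<partial>lborel)
      = (\<integral>\<^sup>+t. \<integral>\<^sup>+s. (indicator (strip S) t * g t) * X (vupd x i s - vec_floor t) \<partial>lborel \<partial>lborel)"
    unfolding cell_op_def by (subst nn_integral_swap) (auto simp: mult_ac)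
  also have "\<dots> = (\<integral>\<^sup>+t. indicator (strip S) t * (X' (x - vec_floor t) * g t) \<partial>lborel)"
    by (subst nn_integral_cmult) (auto simp: shift mult_ac)
  also have "\<dots> = (\<integral>\<^sup>+t. indicator (strip (S - {i})) t * (\<integral>\<^sup>+s. X' (x - vec_floor t) * g (vupd t i s) \<partial>lborel) \<partial>lborel)"
    using \<open>i \<in> S\<close> by (subst nn_integral_strip[where i=i]) (auto simp: X'_floor)
  also have "\<dots> = cell_op (S - {i}) X' (\<lambda>y. \<integral>\<^sup>+s. g (vupd y i s) \<partial>lborel) x"
    unfolding cell_op_def by (subst nn_integral_cmult) (auto simp: mult_ac)
  finally show ?thesis unfolding X'_def .
qed

text \<open>The periodization of the marginal is the average of the periodization of
  \<open>X\<close> over one period in coordinate \<open>i\<close>, and an average keeps the bound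
  \<open>M\<close>.\<close>

lemma cell_op_one_integrate_coord:
  fixes X :: "real^'n \<Rightarrow> ennreal"
  assumes [measurable]: "X \<in> borel_measurable borel" and "i \<in> S"
    and M: "\<And>x. cell_op S X (\<lambda>_. 1) x \<le> M"
  shows "cell_op (S - {i}) (\<lambda>y. \<integral>\<^sup>+s. X (vupd y i s) \<partial>lborel) (\<lambda>_. 1) x \<le> M"
proof -
  have v: "vupd (x - vec_floor t) i (r - of_int \<lfloor>u\<rfloor>) = vupd x i r - vec_floor (vupd t i u)" for t r u
    by (simp add: vec_eq_iff vupd_nth)
  have "cell_op (S - {i}) (\<lambda>y. \<integral>\<^sup>+s. X (vupd y i s) \<partial>lborel) (\<lambda>_. 1) x
     = (\<integral>\<^sup>+t. indicator (strip (S - {i})) t *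
        (\<integral>\<^sup>+r. indicator {0..<1} r * (\<integral>\<^sup>+u. X (vupd x i r - vec_floor (vupd t i u)) \<partial>lborel) \<partial>lborel) \<partial>lborel)"
    unfolding cell_op_def v[symmetric] by (subst nn_integral_periodize_real) auto
  also have "\<dots> = (\<integral>\<^sup>+t. \<integral>\<^sup>+r. indicator (strip (S - {i})) t *
        (indicator {0..<1} r * (\<integral>\<^sup>+u. X (vupd x i r - vec_floor (vupd t i u)) \<partial>lborel)) \<partial>lborel \<partial>lborel)"
    by (subst nn_integral_cmult) auto
  also have "\<dots> = (\<integral>\<^sup>+r. \<integral>\<^sup>+t. indicator (strip (S - {i})) t *
        (indicator {0..<1} r * (\<integral>\<^sup>+u. X (vupd x i r - vec_floor (vupd t i u)) \<partial>lborel)) \<partial>lborel \<partial>lborel)"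
    by (rule nn_integral_swap) measurable
  also have "\<dots> = (\<integral>\<^sup>+r. indicator {0..<1} r * cell_op S X (\<lambda>_. 1) (vupd x i r) \<partial>lborel)"
  proof (rule nn_integral_cong)
    fix r :: real
    have "(\<integral>\<^sup>+t. indicator (strip (S - {i})) t *
        (indicator {0..<1} r * (\<integral>\<^sup>+u. X (vupd x i r - vec_floor (vupd t i u)) \<partial>lborel)) \<partial>lborel)
       = (\<integral>\<^sup>+t. indicator {0..<1} r * (indicator (strip (S - {i})) t *
         (\<integral>\<^sup>+u. X (vupd x i r - vec_floor (vupd t i u)) \<partial>lborel)) \<partial>lborel)"
      by (simp add: mult_ac)
    also have "\<dots> = indicator {0..<1} r * (\<integral>\<^sup>+t. indicator (strip (S - {i})) t *
         (\<integral>\<^sup>+u. X (vupd x i r - vec_floor (vupd t i u)) \<partial>lborel) \<partial>lborel)"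
      by (rule nn_integral_cmult) measurable
    also have "\<dots> = indicator {0..<1} r * cell_op S X (\<lambda>_. 1) (vupd x i r)"
      unfolding cell_op_def
      using nn_integral_strip[of "\<lambda>t. X (vupd x i r - vec_floor t)", OF _ \<open>i \<in> S\<close>] by simp
    finally show "(\<integral>\<^sup>+t. indicator (strip (S - {i})) t *
        (indicator {0..<1} r * (\<integral>\<^sup>+u. X (vupd x i r - vec_floor (vupd t i u)) \<partial>lborel)) \<partial>lborel)
       = indicator {0..<1} r * cell_op S X (\<lambda>_. 1) (vupd x i r)" .
  qed
  also have "\<dots> \<le> (\<integral>\<^sup>+r. indicator {0..<1::real} r * M \<partial>lborel)"
    by (intro nn_integral_mono mult_left_mono M) auto
  also have "\<dots> = M" by (simp add: nn_integral_multc)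
  finally show ?thesis .
qed

text \<open>Here \<open>p\<close> is the exponent used just before the list, and all functions are
  carried under the power 1/p. Jensen with exponent q/p \<ge> 1 costs M powr (1/p - 1/q), and these
  factors telescope to the last exponent. The mass \<open>N\<close> is preserved by every marginal
  and enters only at the end, hence under the last exponent.\<close>

lemma mixnorm_cell_op_le_aux:
  fixes X g :: "real^'n::finite \<Rightarrow> ennreal"
  assumes "\<And>i. 1 \<le> P i" and "0 < M"
    and "1 \<le> p" "sorted (p # map P is)" "distinct is"
    and "X \<in> borel_measurable borel" "g \<in> borel_measurable borel"
    and "depends_only (set is) X" "depends_only (set is) g"
    and "\<And>x. cell_op (set is) X (\<lambda>_. 1) x \<le> ennreal M"
    and "(\<integral>\<^sup>+t. indicator (strip (set is)) t * X t \<partial>lborel) = N"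
  shows "mixnorm_aux is P (\<lambda>x. epowr (cell_op (set is) X g x) (1 / p)) x
    \<le> ennreal (M powr (1 / p - 1 / last (p # map P is))) * epowr N (1 / last (p # map P is)) *
       mixnorm_aux is P (\<lambda>x. epowr (g x) (1 / p)) x"
  using assms(3-)
proof (induction "is" arbitrary: p X g)
  case Nil
  obtain a b where const: "X = (\<lambda>_. a)" "g = (\<lambda>_. b)"
  proof
    show "X = (\<lambda>_. X 0)" "g = (\<lambda>_. g 0)"
      using Nil.prems(6,7) by (auto simp: depends_only_def)
  qed
  \<comment> \<open>No coordinate is left: kernel and function are constants, and the unit cell has
    measure 1.\<close>
  have "N = a"
    using Nil.prems(9) by (simp add: const nn_integral_strip_empty)
  moreover have "cell_op {} X g x = a * b" for x
    unfolding cell_op_def by (simp add: const nn_integral_strip_empty mult.assoc)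
  ultimately show ?case using \<open>0 < M\<close> by (simp add: const epowr_mult)
next
  case (Cons i "is")
  note [measurable] = Cons.prems(4,5)
  define q where "q = P i"
  define r where "r = q / p"
  define S where "S = set (i # is)"
  define X' where "X' = (\<lambda>y. \<integral>\<^sup>+s. X (vupd y i s) \<partial>lborel)"
  define G where "G = (\<lambda>y. \<integral>\<^sup>+s. epowr (g (vupd y i s)) r \<partial>lborel)"
  have q: "1 \<le> q" "p \<le> q" "1 \<le> r" and p: "1 \<le> p"
    using assms(1) Cons.prems by (auto simp: q_def r_def)
  have S: "i \<in> S" "S - {i} = set is" using Cons.prems(3) by (auto simp: S_def)
  have [measurable]: "X' \<in> borel_measurable borel" "G \<in> borel_measurable borel"
    unfolding X'_def G_def by measurable
  \<comment> \<open>The Jensen factor M powr (r - 1) under the outer power 1/q, since r =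
    q/p.\<close>
  define c where "c = M powr (1 / p - 1 / q)"
  have step: "coord_norm q i (\<lambda>x. epowr (cell_op S X g x) (1 / p)) y \<le> ennreal c * epowr (cell_op (set is) X' G y) (1 / q)" for y
  proof -
    have Jensen: "epowr (cell_op S X g x) r \<le> ennreal (M powr (r - 1)) * cell_op S X (\<lambda>t. epowr (g t) r) x" for x
      unfolding cell_op_def using Cons.prems(8)[of x] \<open>0 < M\<close> q
      by (intro nn_integral_Jensen_powr) (auto simp: cell_op_def S_def)
    have "(\<integral>\<^sup>+t. epowr (epowr (cell_op S X g (vupd y i t)) (1 / p)) q \<partial>lborel)
       \<le> (\<integral>\<^sup>+t. ennreal (M powr (r - 1)) * cell_op S X (\<lambda>t. epowr (g t) r) (vupd y i t) \<partial>lborel)"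
      using Jensen by (intro nn_integral_mono) (simp add: epowr_epowr r_def)
    also have "\<dots> = ennreal (M powr (r - 1)) * (\<integral>\<^sup>+t. cell_op S X (\<lambda>t. epowr (g t) r) (vupd y i t) \<partial>lborel)"
      by (rule nn_integral_cmult) measurable
    also have "\<dots> = ennreal (M powr (r - 1)) * cell_op (set is) X' G y"
      by (subst cell_op_integrate_coord) (auto simp: S X'_def G_def)
    finally have "coord_norm q i (\<lambda>x. epowr (cell_op S X g x) (1 / p)) y
      \<le> epowr (ennreal (M powr (r - 1)) * cell_op (set is) X' G y) (1 / q)"
      unfolding coord_norm_def using q by (intro epowr_mono) auto
    also have "\<dots> = ennreal c * epowr (cell_op (set is) X' G y) (1 / q)"
      using p q by (simp add: epowr_mult epowr_ennreal powr_powr c_def r_def field_simps)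
    finally show ?thesis .
  qed
  have "mixnorm_aux (i # is) P (\<lambda>x. epowr (cell_op S X g x) (1 / p)) x
    \<le> mixnorm_aux is P (\<lambda>y. ennreal c * epowr (cell_op (set is) X' G y) (1 / q)) x"
    unfolding mixnorm_aux_Cons using step assms(1) by (intro mixnorm_aux_mono) (auto simp: q_def)
  also have "\<dots> = ennreal c * mixnorm_aux is P (\<lambda>y. epowr (cell_op (set is) X' G y) (1 / q)) x"
    using assms(1) by (intro mixnorm_aux_cmult) auto
  also have "\<dots> \<le> ennreal c * (ennreal (M powr (1 / q - 1 / last (q # map P is))) * epowr N (1 / last (q # map P is)) *
       mixnorm_aux is P (\<lambda>x. epowr (G x) (1 / q)) x)"
  proof (intro mult_left_mono Cons.IH)
    show "sorted (q # map P is)" "distinct is" using Cons.prems by (auto simp: q_def)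
    have "depends_only (S - {i}) X'"
      unfolding X'_def using Cons.prems(6) depends_only_vupd[of S X i "\<lambda>h. \<integral>\<^sup>+s. h s \<partial>lborel"] by (simp add: S_def)
    then show "depends_only (set is) X'" by (simp add: S)
    have "depends_only (S - {i}) G"
      unfolding G_def using Cons.prems(7) depends_only_vupd[of S g i "\<lambda>h. \<integral>\<^sup>+s. epowr (h s) r \<partial>lborel"] by (simp add: S_def)
    then show "depends_only (set is) G" by (simp add: S)
    show "cell_op (set is) X' (\<lambda>_. 1) x \<le> ennreal M" for x
      unfolding X'_def S(2)[symmetric] using Cons.prems(8)
      by (intro cell_op_one_integrate_coord) (auto simp: S_def)
    show "(\<integral>\<^sup>+t. indicator (strip (set is)) t * X' t \<partial>lborel) = N"
      unfolding X'_def S(2)[symmetric] using Cons.prems(9)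
      by (subst nn_integral_strip[symmetric]) (auto simp: S_def)
  qed (use q in auto)
  also have "mixnorm_aux is P (\<lambda>x. epowr (G x) (1 / q)) x = mixnorm_aux (i # is) P (\<lambda>x. epowr (g x) (1 / p)) x"
    unfolding mixnorm_aux_Cons coord_norm_def[abs_def] G_def by (simp add: epowr_epowr r_def q_def)
  also have "last (q # map P is) = last (p # map P (i # is))" by (simp add: q_def)
  also have "ennreal c * (ennreal (M powr (1 / q - 1 / last (p # map P (i # is)))) * a * b)
     = ennreal (M powr (1 / p - 1 / last (p # map P (i # is)))) * a * b" for a b
    using \<open>0 < M\<close> by (simp add: c_def mult.assoc[symmetric] powr_add[symmetric] flip: ennreal_mult)
  finally show ?case by (simp only: S_def)
qed

lemma cell_op_UNIV: "cell_op UNIV X g x = (\<integral>\<^sup>+t. X (x - vec_floor t) * g t \<partial>lborel)"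
  by (simp add: cell_op_def strip_def)

text \<open>The positive majorant of the Kantorovich operator, the sum over the lattice being written
  as an integral: \<open>t\<close> lies in the cell of index \<open>\<lfloor>w t\<rfloor>\<close>.\<close>
definition kant_op :: "(real^'n \<Rightarrow> ennreal) \<Rightarrow> real \<Rightarrow> (real^'n \<Rightarrow> ennreal) \<Rightarrow> real^'n::finite \<Rightarrow> ennreal" where
  "kant_op X w g x = ennreal (w ^ CARD('n)) * (\<integral>\<^sup>+t. X (w *\<^sub>R x - vec_floor (w *\<^sub>R t)) * g t \<partial>lborel)"

lemma kant_op_eq_cell_op:
  fixes X g :: "real^'n \<Rightarrow> ennreal"
  assumes [measurable]: "X \<in> borel_measurable borel" "g \<in> borel_measurable borel" and "0 < w"
  shows "kant_op X w g x = cell_op UNIV X (\<lambda>t. g ((1 / w) *\<^sub>R t)) (w *\<^sub>R x)"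
  unfolding kant_op_def cell_op_UNIV
  using nn_integral_lborel_scale[of "\<lambda>t. X (w *\<^sub>R x - vec_floor t) * g ((1 / w) *\<^sub>R t)" w] \<open>0 < w\<close> by simp

lemma borel_measurable_kant_op [measurable]:
  assumes [measurable]: "X \<in> borel_measurable borel" "g \<in> borel_measurable borel"
  shows "kant_op X w g \<in> borel_measurable borel"
  unfolding kant_op_def by measurable

text \<open>The operator is \<open>cell_op\<close> conjugated by the dilation with factor
  \<open>w\<close>. The dilation factors of the two sides agree, so the bound does not depend on
  \<open>w\<close>.\<close>

lemma mixnorm_kant_op_le:
  fixes X g :: "real^'n::finite \<Rightarrow> ennreal"
  assumes P: "\<And>i. 1 \<le> P i" and "sorted (map P is)" "distinct is" "set is = UNIV"
    and [measurable]: "X \<in> borel_measurable borel" "g \<in> borel_measurable borel"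
    and "\<And>x. (\<integral>\<^sup>+t. X (x - vec_floor t) \<partial>lborel) \<le> ennreal M" and "0 < M" "0 < w"
  shows "mixnorm_aux is P (kant_op X w g) 0
    \<le> ennreal (M powr (1 - 1 / last (1 # map P is))) * epowr (\<integral>\<^sup>+t. X t \<partial>lborel) (1 / last (1 # map P is)) *
       mixnorm_aux is P g 0"
proof -
  define h where "h = (\<lambda>t. g ((1 / w) *\<^sub>R t))"
  define C where "C = ennreal (M powr (1 - 1 / last (1 # map P is))) * epowr (\<integral>\<^sup>+t. X t \<partial>lborel) (1 / last (1 # map P is))"
  have [measurable]: "h \<in> borel_measurable borel" unfolding h_def by measurable
  let ?c = "\<Prod>i\<leftarrow>is. ennreal (w powr (- 1 / P i))"
  have "kant_op X w g = (\<lambda>x. cell_op UNIV X h (w *\<^sub>R x))"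
    using \<open>0 < w\<close> by (intro ext) (simp add: kant_op_eq_cell_op h_def)
  then have "mixnorm_aux is P (kant_op X w g) 0 = mixnorm_aux is P (\<lambda>x. cell_op UNIV X h (w *\<^sub>R x)) 0"
    by simp
  also have "\<dots> = ?c * mixnorm_aux is P (cell_op UNIV X h) 0"
    using P \<open>0 < w\<close> by (subst mixnorm_aux_scale) auto
  also have "mixnorm_aux is P (cell_op UNIV X h) 0 \<le> C * mixnorm_aux is P h 0"
  proof -
    \<comment> \<open>The trivial exponent 1 starts the induction; it is below every
      \<open>P i\<close>, so the extended list is still sorted.\<close>
    have "mixnorm_aux is P (\<lambda>x. epowr (cell_op (set is) X h x) (1 / 1)) 0 \<le>
      ennreal (M powr (1 / 1 - 1 / last (1 # map P is))) * epowr (\<integral>\<^sup>+t. X t \<partial>lborel) (1 / last (1 # map P is)) * mixnorm_aux is P (\<lambda>x. epowr (h x) (1 / 1)) 0"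
      by (rule mixnorm_cell_op_le_aux)
         (use assms in \<open>auto simp: cell_op_UNIV depends_only_def strip_def simp flip: vec_eq_iff\<close>)
    then show ?thesis by (simp add: C_def assms(4))
  qed
  also have "?c * (C * mixnorm_aux is P h 0) = C * mixnorm_aux is P (\<lambda>x. h (w *\<^sub>R x)) 0"
    using P \<open>0 < w\<close> by (subst mixnorm_aux_scale) (auto simp: mult_ac)
  also have "(\<lambda>x. h (w *\<^sub>R x)) = g" using \<open>0 < w\<close> by (simp add: h_def)
  finally show ?thesis by (simp add: C_def mult_left_mono)
qed

section \<open>Oscillation of a function under the operator\<close>

text \<open>With the absolute value of the kernel as \<open>X\<close>, this dominates the error of
  the Kantorovich operator, because the kernel sums to 1 over the lattice and f(x) can be moved
  under the sum.\<close>

definition osc_op :: "(real^'n \<Rightarrow> ennreal) \<Rightarrow> real \<Rightarrow> (real^'n \<Rightarrow> real) \<Rightarrow> real^'n::finite \<Rightarrow> ennreal" where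
  "osc_op X w f x = kant_op X w (\<lambda>t. ennreal \<bar>f t - f x\<bar>) x"

lemma borel_measurable_osc_op [measurable]:
  assumes [measurable]: "X \<in> borel_measurable borel" "f \<in> borel_measurable borel"
  shows "osc_op X w f \<in> borel_measurable borel"
  unfolding osc_op_def kant_op_def by measurable

lemma kant_op_mono: "(\<And>t. g t \<le> h t) \<Longrightarrow> kant_op X w g x \<le> kant_op X w h x"
  unfolding kant_op_def by (intro mult_left_mono nn_integral_mono) auto

lemma kant_op_add:
  assumes [measurable]: "X \<in> borel_measurable borel" "g \<in> borel_measurable borel" "h \<in> borel_measurable borel"
  shows "kant_op X w (\<lambda>t. g t + h t) x = kant_op X w g x + kant_op X w h x"
  unfolding kant_op_def by (simp add: distrib_left nn_integral_add)

lemma kant_op_const: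
  fixes X :: "real^'n \<Rightarrow> ennreal"
  assumes [measurable]: "X \<in> borel_measurable borel" and "0 < w"
  shows "kant_op X w (\<lambda>_. c) x = (\<integral>\<^sup>+t. X (w *\<^sub>R x - vec_floor t) \<partial>lborel) * c"
  using assms(2) by (subst kant_op_eq_cell_op) (auto simp: cell_op_UNIV nn_integral_multc)

text \<open>Triangle inequality through g(t) and g(x). The term with f(x) - g(x) is constant in
  \<open>t\<close>, so the operator only multiplies it by the periodization, at most
  \<open>M\<close>.\<close>

lemma osc_op_le:
  fixes X :: "real^'n::finite \<Rightarrow> ennreal"
  assumes [measurable]: "X \<in> borel_measurable borel" "f \<in> borel_measurable borel" "g \<in> borel_measurable borel"
    and M: "\<And>x. (\<integral>\<^sup>+t. X (x - vec_floor t) \<partial>lborel) \<le> ennreal M" and "0 < w"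
  shows "osc_op X w f x \<le> osc_op X w g x + (kant_op X w (\<lambda>t. ennreal \<bar>f t - g t\<bar>) x + ennreal M * ennreal \<bar>f x - g x\<bar>)"
proof -
  have "osc_op X w f x \<le> kant_op X w (\<lambda>t. ennreal \<bar>g t - g x\<bar> + (ennreal \<bar>f t - g t\<bar> + ennreal \<bar>f x - g x\<bar>)) x"
    unfolding osc_op_def by (intro kant_op_mono) (simp flip: ennreal_plus)
  also have "\<dots> = osc_op X w g x + (kant_op X w (\<lambda>t. ennreal \<bar>f t - g t\<bar>) x + kant_op X w (\<lambda>_. ennreal \<bar>f x - g x\<bar>) x)"
    unfolding osc_op_def by (simp add: kant_op_add)
  also have "kant_op X w (\<lambda>_. ennreal \<bar>f x - g x\<bar>) x \<le> ennreal M * ennreal \<bar>f x - g x\<bar>"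
    using \<open>0 < w\<close> by (simp add: kant_op_const M mult_right_mono)
  finally show ?thesis by (simp add: add_left_mono)
qed

lemma vec_floor_add_vec_floor: "vec_floor (t + vec_floor s) = vec_floor t + vec_floor s"
  by (simp add: vec_eq_iff)

lemma vec_floor_diff_vec_floor: "vec_floor (t - vec_floor s) = vec_floor t - vec_floor s"
  by (simp add: vec_eq_iff)

lemma vec_floor_in_Zn: "vec_floor t \<in> Zn"
  by (simp add: Zn_def)

lemma uminus_vec_floor_in_Zn: "- vec_floor t \<in> Zn"
  by (simp add: Zn_def)

lemma nn_integral_periodic:
  fixes X :: "real^'n \<Rightarrow> ennreal"
  assumes [measurable]: "X \<in> borel_measurable borel"
  shows "(\<integral>\<^sup>+t. X (x - vec_floor s - vec_floor t) \<partial>lborel) = (\<integral>\<^sup>+t. X (x - vec_floor t) \<partial>lborel)"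
  using nn_integral_lborel_shift[of "\<lambda>t. X (x - vec_floor t)" "vec_floor s"]
  by (simp add: vec_floor_add_vec_floor algebra_simps)

text \<open>Restricting the periodization of \<open>X\<close> to the unit cell gives a kernel of the same mass for which
  the operator is multiplication by the periodization, up to averaging over cells.\<close>
definition cell_kernel :: "(real^'n \<Rightarrow> ennreal) \<Rightarrow> real^'n::finite \<Rightarrow> ennreal" where
  "cell_kernel X y = indicator {y. vec_floor y = 0} y * (\<integral>\<^sup>+t. X (y - vec_floor t) \<partial>lborel)"

lemma borel_measurable_cell_kernel [measurable]:
  assumes [measurable]: "X \<in> borel_measurable borel"
  shows "cell_kernel X \<in> borel_measurable borel"
  unfolding cell_kernel_def by measurable

lemma cell_kernel_shift:
  fixes X :: "real^'n \<Rightarrow> ennreal"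
  assumes [measurable]: "X \<in> borel_measurable borel"
  shows "cell_kernel X (x - vec_floor t) = indicator {t. vec_floor t = vec_floor x} t * (\<integral>\<^sup>+t. X (x - vec_floor t) \<partial>lborel)"
  unfolding cell_kernel_def by (auto simp: vec_floor_diff_vec_floor nn_integral_periodic indicator_def)

lemma nn_integral_cell_kernel_shift:
  fixes X :: "real^'n \<Rightarrow> ennreal"
  assumes [measurable]: "X \<in> borel_measurable borel"
  shows "(\<integral>\<^sup>+t. cell_kernel X (x - vec_floor t) \<partial>lborel) = (\<integral>\<^sup>+t. X (x - vec_floor t) \<partial>lborel)"
  by (simp add: cell_kernel_shift nn_integral_multc emeasure_unit_cell vec_floor_in_Zn)

text \<open>Unfolding: integrating a periodization over one cell recovers the full integral, since
  each \<open>x\<close> is moved into the unit cell by exactly one lattice vector, that is, by a set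
  of \<open>t\<close> of measure 1.\<close>

lemma nn_integral_cell_kernel:
  fixes X :: "real^'n \<Rightarrow> ennreal"
  assumes [measurable]: "X \<in> borel_measurable borel"
  shows "(\<integral>\<^sup>+x. cell_kernel X x \<partial>lborel) = (\<integral>\<^sup>+x. X x \<partial>lborel)"
proof -
  let ?Q = "{y :: real^'n. vec_floor y = 0}"
  have "(\<integral>\<^sup>+x. cell_kernel X x \<partial>lborel) = (\<integral>\<^sup>+x. \<integral>\<^sup>+t. indicator ?Q x * X (x - vec_floor t) \<partial>lborel \<partial>lborel)"
    unfolding cell_kernel_def by (subst nn_integral_cmult) auto
  also have "\<dots> = (\<integral>\<^sup>+t. \<integral>\<^sup>+x. indicator ?Q x * X (x - vec_floor t) \<partial>lborel \<partial>lborel)"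
    by (rule nn_integral_swap) measurable
  also have "\<dots> = (\<integral>\<^sup>+t. \<integral>\<^sup>+x. indicator {t. vec_floor t = - vec_floor x} t * X x \<partial>lborel \<partial>lborel)"
  proof (rule nn_integral_cong)
    fix t :: "real^'n"
    have "indicator ?Q (x + vec_floor t) = (indicator {t. vec_floor t = - vec_floor x} t :: ennreal)" for x
      by (auto simp: vec_floor_add_vec_floor indicator_def add_eq_0_iff)
    then show "(\<integral>\<^sup>+x. indicator ?Q x * X (x - vec_floor t) \<partial>lborel) = (\<integral>\<^sup>+x. indicator {t. vec_floor t = - vec_floor x} t * X x \<partial>lborel)"
      using nn_integral_lborel_shift[of "\<lambda>x. indicator ?Q x * X (x - vec_floor t)" "vec_floor t"] by simp
  qed
  also have "\<dots> = (\<integral>\<^sup>+x. \<integral>\<^sup>+t. indicator {t. vec_floor t = - vec_floor x} t * X x \<partial>lborel \<partial>lborel)"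
  proof (rule nn_integral_swap)
    \<comment> \<open>The set under the indicator varies with \<open>x\<close>, so joint
      measurability is obtained by writing the condition as a zero set in the product.\<close>
    have "{z :: (real^'n) \<times> (real^'n). vec_floor (fst z) + vec_floor (snd z) = 0} \<in> sets (borel \<Otimes>\<^sub>M borel)"
    proof -
      have "(\<lambda>z :: (real^'n) \<times> (real^'n). vec_floor (fst z) + vec_floor (snd z)) -` {0} \<inter> space (borel \<Otimes>\<^sub>M borel) \<in> sets (borel \<Otimes>\<^sub>M borel)"
        by (rule measurable_sets[where A=borel]) auto
      then show ?thesis by (simp add: space_pair_measure vimage_def)
    qed
    then have "(\<lambda>z. indicator {z :: (real^'n) \<times> (real^'n). vec_floor (fst z) + vec_floor (snd z) = 0} z * X (snd z)) \<in> borel_measurable (borel \<Otimes>\<^sub>M borel)"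
      by measurable
    moreover have "(\<lambda>(t, x). indicator {t. vec_floor t = - vec_floor x} t * X x) =
       (\<lambda>z. indicator {z :: (real^'n) \<times> (real^'n). vec_floor (fst z) + vec_floor (snd z) = 0} z * X (snd z))"
      by (auto simp: fun_eq_iff indicator_def eq_neg_iff_add_eq_0)
    ultimately show "(\<lambda>(t, x). indicator {t. vec_floor t = - vec_floor x} t * X x) \<in> borel_measurable (borel \<Otimes>\<^sub>M borel)"
      by simp
  qed
  also have "\<dots> = (\<integral>\<^sup>+x. X x \<partial>lborel)"
    by (simp add: nn_integral_multc emeasure_unit_cell uminus_vec_floor_in_Zn)
  finally show ?thesis .
qed

lemma norm_diff_vec_floor_le: "norm (t - vec_floor t) \<le> real CARD('n)" for t :: "real^'n"
proof -
  have "norm (t - vec_floor t) \<le> (\<Sum>i\<in>UNIV. \<bar>(t - vec_floor t) $ i\<bar>)" by (rule norm_le_l1_cart)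
  also have "\<dots> \<le> (\<Sum>i\<in>(UNIV::'n set). 1)"
  proof (rule sum_mono)
    fix i :: 'n
    show "\<bar>(t - vec_floor t) $ i\<bar> \<le> 1"
      using floor_correct[of "t $ i"] by simp linarith
  qed
  finally show ?thesis by simp
qed

text \<open>Turns multiplication by the periodization into an operator. Points in the same unit cell
  as w x are within 2n of it, so for w > 2n their rescalings lie within 1 of x, where the indicator
  is 1.\<close>

lemma kant_op_cell_kernel_ge:
  fixes X :: "real^'n \<Rightarrow> ennreal"
  assumes [measurable]: "X \<in> borel_measurable borel" and w: "real CARD('n) * 2 < w" and "norm x \<le> L"
  shows "(\<integral>\<^sup>+t. X (w *\<^sub>R x - vec_floor t) \<partial>lborel) \<le> kant_op (cell_kernel X) w (indicator (cball 0 (L + 1))) x"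
proof -
  have w0: "0 < w" using w by (smt (verit) of_nat_0_le_iff mult_nonneg_nonneg)
  define B where "B = (\<integral>\<^sup>+t. X (w *\<^sub>R x - vec_floor t) \<partial>lborel)"
  have near: "(1 / w) *\<^sub>R t \<in> cball 0 (L + 1)" if "vec_floor t = vec_floor (w *\<^sub>R x)" for t
  proof -
    have "norm (t - w *\<^sub>R x) \<le> norm (t - vec_floor t) + norm (w *\<^sub>R x - vec_floor (w *\<^sub>R x))"
      using that norm_triangle_ineq4[of "t - vec_floor t" "w *\<^sub>R x - vec_floor (w *\<^sub>R x)"] by simp
    also have "\<dots> \<le> real CARD('n) + real CARD('n)" by (intro add_mono norm_diff_vec_floor_le)
    also have "\<dots> \<le> w" using w by simp
    finally have le: "norm (t - w *\<^sub>R x) \<le> w" .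
    have "norm t \<le> norm (t - w *\<^sub>R x) + norm (w *\<^sub>R x)" by (metis norm_triangle_sub add.commute norm_minus_commute)
    also have "\<dots> \<le> w + w * L" using le w0 assms(3) by (intro add_mono) (auto intro: mult_left_mono)
    finally show ?thesis using w0 by (simp add: field_simps)
  qed
  have "B = (\<integral>\<^sup>+t. indicator {t. vec_floor t = vec_floor (w *\<^sub>R x)} t * B \<partial>lborel)"
    by (simp add: nn_integral_multc emeasure_unit_cell vec_floor_in_Zn)
  also have "\<dots> \<le> cell_op UNIV (cell_kernel X) (\<lambda>t. indicator (cball 0 (L + 1)) ((1 / w) *\<^sub>R t)) (w *\<^sub>R x)"
    unfolding cell_op_UNIV cell_kernel_shift[OF assms(1)] B_def[symmetric]
    using near by (intro nn_integral_mono) (auto simp: indicator_def)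
  also have "\<dots> = kant_op (cell_kernel X) w (indicator (cball 0 (L + 1))) x"
    using w0 by (subst kant_op_eq_cell_op) (auto intro!: borel_measurable_indicator)
  finally show ?thesis by (simp add: B_def)
qed

text \<open>When the kernel argument has norm at most \<open>R\<close>, the points \<open>x\<close>
  and \<open>t\<close> are \<delta>-close and the modulus of continuity applies. Otherwise
  \<bar>g(t) - g(x)\<bar> is split, and both parts see only the tail \<open>XR\<close>.\<close>

lemma osc_op_compact_support_le:
  fixes X :: "real^'n \<Rightarrow> ennreal" and g :: "real^'n \<Rightarrow> real"
  assumes [measurable]: "X \<in> borel_measurable borel" "g \<in> borel_measurable borel"
    and M: "\<And>x. (\<integral>\<^sup>+t. X (x - vec_floor t) \<partial>lborel) \<le> ennreal M"
    and F: "\<And>x. \<bar>g x\<bar> \<le> F" and L: "\<And>x. L < norm x \<Longrightarrow> g x = 0"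
    and w: "real CARD('n) * 2 < w" and d: "0 < \<delta>" "\<delta> \<le> 1" "R + real CARD('n) < w * \<delta>"
    and cont: "\<And>x t. dist x t < \<delta> \<Longrightarrow> \<bar>g t - g x\<bar> \<le> \<eta>"
  defines "XR \<equiv> (\<lambda>v. X v * indicator {v. R < norm v} v)"
  shows "osc_op X w g x \<le> ennreal (M * \<eta>) * indicator (cball 0 (L + 1)) x +
    (kant_op XR w (\<lambda>t. ennreal \<bar>g t\<bar>) x + ennreal F * kant_op (cell_kernel XR) w (indicator (cball 0 (L + 1))) x)"
proof -
  have w0: "0 < w" using w by (smt (verit) of_nat_0_le_iff mult_nonneg_nonneg)
  have [measurable]: "XR \<in> borel_measurable borel" unfolding XR_def by measurable
  define D where "D = cball (0::real^'n) (L + 1)"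
  have [measurable]: "D \<in> sets borel" by (simp add: D_def)
  have \<eta>: "0 \<le> \<eta>" using cont[of x x] d(1) by simp
  have pt: "X (w *\<^sub>R x - vec_floor (w *\<^sub>R t)) * ennreal \<bar>g t - g x\<bar> \<le>
      X (w *\<^sub>R x - vec_floor (w *\<^sub>R t)) * (ennreal \<eta> * indicator D x)
      + (XR (w *\<^sub>R x - vec_floor (w *\<^sub>R t)) * ennreal \<bar>g t\<bar> + XR (w *\<^sub>R x - vec_floor (w *\<^sub>R t)) * ennreal \<bar>g x\<bar>)" for t
  proof (cases "norm (w *\<^sub>R x - vec_floor (w *\<^sub>R t)) \<le> R")
    case True
    have "norm (w *\<^sub>R x - w *\<^sub>R t) \<le> norm (w *\<^sub>R x - vec_floor (w *\<^sub>R t)) + norm (w *\<^sub>R t - vec_floor (w *\<^sub>R t))"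
      using norm_triangle_ineq4[of "w *\<^sub>R x - vec_floor (w *\<^sub>R t)" "w *\<^sub>R t - vec_floor (w *\<^sub>R t)"] by simp
    also have "\<dots> \<le> R + real CARD('n)" by (intro add_mono norm_diff_vec_floor_le True)
    also note d(3)
    finally have "w * dist x t < w * \<delta>"
      using w0 by (simp add: dist_norm scaleR_diff_right[symmetric])
    then have dist: "dist x t < \<delta>" using w0 by simp
    \<comment> \<open>As \<delta> \<le> 1, a point beyond radius L + 1 has only neighbours beyond
      \<open>L\<close>; this confines the main term to a fixed ball.\<close>
    have "\<bar>g t - g x\<bar> = 0" if "x \<notin> D"
    proof -
      have "L + 1 < norm x" using that by (simp add: D_def)
      moreover have "norm x \<le> norm t + dist x t" by (metis add.commute dist_norm norm_triangle_sub)
      ultimately show ?thesis using dist d(2) L[of x] L[of t] by simp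
    qed
    then have "ennreal \<bar>g t - g x\<bar> \<le> ennreal \<eta> * indicator D x"
      using cont[OF dist] by (auto simp: indicator_def ennreal_leI)
    then show ?thesis by (intro add_increasing2 mult_left_mono) auto
  next
    case False
    then have "XR (w *\<^sub>R x - vec_floor (w *\<^sub>R t)) = X (w *\<^sub>R x - vec_floor (w *\<^sub>R t))"
      by (simp add: XR_def)
    moreover have "ennreal \<bar>g t - g x\<bar> \<le> ennreal \<bar>g t\<bar> + ennreal \<bar>g x\<bar>"
      by (simp flip: ennreal_plus)
    then have "X (w *\<^sub>R x - vec_floor (w *\<^sub>R t)) * ennreal \<bar>g t - g x\<bar> \<le>
        X (w *\<^sub>R x - vec_floor (w *\<^sub>R t)) * (ennreal \<bar>g t\<bar> + ennreal \<bar>g x\<bar>)"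
      by (rule mult_left_mono) simp
    ultimately show ?thesis
      by (simp add: distrib_left add_increasing)
  qed
  have "osc_op X w g x \<le> kant_op X w (\<lambda>_. ennreal \<eta> * indicator D x) x
     + (kant_op XR w (\<lambda>t. ennreal \<bar>g t\<bar>) x + kant_op XR w (\<lambda>_. ennreal \<bar>g x\<bar>) x)"
  proof -
    have "osc_op X w g x \<le> ennreal (w ^ CARD('n)) * (\<integral>\<^sup>+t. X (w *\<^sub>R x - vec_floor (w *\<^sub>R t)) * (ennreal \<eta> * indicator D x)
      + (XR (w *\<^sub>R x - vec_floor (w *\<^sub>R t)) * ennreal \<bar>g t\<bar> + XR (w *\<^sub>R x - vec_floor (w *\<^sub>R t)) * ennreal \<bar>g x\<bar>) \<partial>lborel)"
      unfolding osc_op_def kant_op_def by (intro mult_left_mono nn_integral_mono pt) auto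
    then show ?thesis unfolding kant_op_def by (simp add: nn_integral_add distrib_left)
  qed
  also have "kant_op X w (\<lambda>_. ennreal \<eta> * indicator D x) x \<le> ennreal (M * \<eta>) * indicator D x"
  proof -
    have "kant_op X w (\<lambda>_. ennreal \<eta> * indicator D x) x \<le> ennreal M * (ennreal \<eta> * indicator D x)"
      using w0 by (simp add: kant_op_const M mult_right_mono)
    then show ?thesis using \<eta> by (simp add: ennreal_mult'' mult.assoc)
  qed
  \<comment> \<open>The factor g(x) stands outside the integral, so the tail acts by multiplication
    here; \<open>cell_kernel\<close> brings it back to operator form.\<close>
  also have "kant_op XR w (\<lambda>_. ennreal \<bar>g x\<bar>) x \<le> ennreal F * kant_op (cell_kernel XR) w (indicator D) x"
  proof (cases "norm x \<le> L")
    case True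
    have "kant_op XR w (\<lambda>_. ennreal \<bar>g x\<bar>) x = (\<integral>\<^sup>+t. XR (w *\<^sub>R x - vec_floor t) \<partial>lborel) * ennreal \<bar>g x\<bar>"
      using w0 by (simp add: kant_op_const)
    also have "\<dots> \<le> kant_op (cell_kernel XR) w (indicator D) x * ennreal F"
      unfolding D_def by (intro mult_mono kant_op_cell_kernel_ge w True ennreal_leI F) auto
    finally show ?thesis by (simp add: mult.commute)
  next
    case False
    then have "g x = 0" by (intro L) simp
    then show ?thesis by (simp add: kant_op_def)
  qed
  finally show ?thesis by (simp add: D_def add_mono)
qed

section \<open>Convergence for Borel functions\<close>

lemma tendsto_0_ennreal_approx:
  fixes f :: "'a \<Rightarrow> ennreal" and s :: "nat \<Rightarrow> ennreal"
  assumes "\<And>m. eventually (\<lambda>x. f x \<le> s m) F" "s \<longlonglongrightarrow> 0"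
  shows "(f \<longlongrightarrow> 0) F"
proof (rule order_tendstoI)
  fix a :: ennreal assume "0 < a"
  then have "\<forall>\<^sub>F m in sequentially. s m < a" using assms(2) by (auto dest: order_tendstoD)
  then obtain m where "s m < a" by (metis eventually_sequentially order_refl)
  with assms(1)[of m] show "\<forall>\<^sub>F x in F. f x < a" by (auto elim!: eventually_mono)
qed simp

text \<open>Uniform continuity is taken on the ball of radius L + 1. With \<delta> \<le> 1, a close
  pair not contained in that ball lies entirely beyond \<open>L\<close>, where g = 0.\<close>

lemma uniform_modulus_compact_support:
  fixes g :: "'a::euclidean_space \<Rightarrow> real"
  assumes "continuous_on UNIV g" and L: "\<And>x. L < norm x \<Longrightarrow> g x = 0" and "0 < \<eta>"
  obtains \<delta> where "0 < \<delta>" "\<delta> \<le> 1" "\<And>x t. dist x t < \<delta> \<Longrightarrow> \<bar>g t - g x\<bar> \<le> \<eta>"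
proof -
  have "uniformly_continuous_on (cball 0 (L + 1)) g"
    using assms(1) by (intro compact_uniformly_continuous) (auto intro: continuous_on_subset)
  then obtain d where d: "0 < d" "\<And>x t. \<lbrakk>x \<in> cball 0 (L+1); t \<in> cball 0 (L+1); dist t x < d\<rbrakk> \<Longrightarrow> dist (g t) (g x) < \<eta>"
    using \<open>0 < \<eta>\<close> unfolding uniformly_continuous_on_def by metis
  show ?thesis
  proof (rule that[of "min d 1"])
    fix x t :: 'a assume dist: "dist x t < min d 1"
    show "\<bar>g t - g x\<bar> \<le> \<eta>"
    proof (cases "x \<in> cball 0 (L+1) \<and> t \<in> cball 0 (L+1)")
      case True
      then show ?thesis using d(2)[of x t] dist by (auto simp: dist_real_def dist_commute)
    next
      case False
      have "norm x \<le> norm t + dist x t" "norm t \<le> norm x + dist x t"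
        by (metis add.commute dist_norm norm_triangle_sub dist_commute)+
      then have "g x = 0" "g t = 0" using False dist by (auto intro!: L)
      then show ?thesis using \<open>0 < \<eta>\<close> by simp
    qed
  qed (use d in auto)
qed

lemma tendsto_mult_finite_0:
  fixes f :: "'a \<Rightarrow> ennreal"
  assumes "(f \<longlongrightarrow> 0) F" "c < top"
  shows "((\<lambda>x. c * f x) \<longlongrightarrow> 0) F"
  using ennreal_tendsto_cmult[OF assms(2,1)] by simp

lemma tendsto_add_0:
  fixes f g :: "'a \<Rightarrow> ennreal"
  assumes "(f \<longlongrightarrow> 0) F" "(g \<longlongrightarrow> 0) F"
  shows "((\<lambda>x. f x + g x) \<longlongrightarrow> 0) F"
  using tendsto_add[OF assms] by simp

lemma LIMSEQ_ennreal_inverse_Suc: "(\<lambda>m. ennreal (1 / real (Suc m))) \<longlonglongrightarrow> 0"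
  using tendsto_ennrealI[OF LIMSEQ_inverse_real_of_nat] by (simp add: inverse_eq_divide)

lemma power2_less_top: "(2::ennreal) ^ l < top"
  by (simp add: power_less_top_ennreal)

context
  fixes P :: "'n::finite \<Rightarrow> real" and "is" :: "'n list"
  assumes P: "\<And>i. 1 \<le> P i" and srt: "sorted (map P is)" and dist: "distinct is" and setis: "set is = UNIV"
begin

private abbreviation "nrm g \<equiv> mixnorm_aux is P g 0"
private abbreviation "q \<equiv> last (1 # map P is)"

lemma last_exponent_pos: "0 < q"
proof -
  have "last (1 # map P is) \<in> set (1 # map P is)" by (rule last_in_set) simp
  then have "1 \<le> q" using P by auto
  then show ?thesis by linarith
qed

lemma mixnorm_add: "g \<in> borel_measurable borel \<Longrightarrow> h \<in> borel_measurable borel \<Longrightarrow> nrm (\<lambda>x. g x + h x) \<le> 2 ^ length is * (nrm g + nrm h)"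
  by (rule mixnorm_aux_add[OF P])

lemma mixnorm_mono: "(\<And>x. g x \<le> h x) \<Longrightarrow> nrm g \<le> nrm h"
  by (rule mixnorm_aux_mono[OF P])

lemma mixnorm_cmult: "g \<in> borel_measurable borel \<Longrightarrow> nrm (\<lambda>x. c * g x) = c * nrm g"
  by (rule mixnorm_aux_cmult[OF P])

section \<open>Density of continuous compactly supported functions in the mixed norm\<close>

lemma mixnorm_finite_compact_support:
  assumes "0 \<le> C" "\<And>x. g x \<le> ennreal C" "\<And>x. L < norm x \<Longrightarrow> g x = 0"
  shows "nrm g < top"
proof (rule mixnorm_aux_finite[OF P dist assms(1), where L="max L 0"])
  fix x :: "real^'n" and i assume "max L 0 < \<bar>x $ i\<bar>"
  then show "g x = 0" using component_le_norm_cart[of x i] by (intro assms(3)) linarith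
qed (use assms in auto)

lemma approx_compact_support_bounded:
  fixes f :: "real^'n \<Rightarrow> real"
  assumes [measurable]: "f \<in> borel_measurable borel" and F: "\<And>x. \<bar>f x\<bar> \<le> F" and L: "\<And>x. L < norm x \<Longrightarrow> f x = 0" and "0 < e"
  shows "\<exists>g. continuous_on UNIV g \<and> (\<forall>x. \<bar>g x\<bar> \<le> F) \<and> (\<forall>x. L + 1 < norm x \<longrightarrow> g x = 0) \<and> nrm (\<lambda>x. ennreal \<bar>f x - g x\<bar>) < e"
proof -
  have F0: "0 \<le> F" using F[of 0] by linarith
  have "f \<in> borel_measurable lebesgue" by (rule measurable_completion) simp
  then have "f measurable_on UNIV" by (rule lebesgue_measurable_imp_measurable_on_real) simp
  then obtain Z h where Z: "negligible Z" and h: "\<And>n. continuous_on UNIV (h n)"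
    and lim: "\<And>x. x \<notin> Z \<Longrightarrow> (\<lambda>n. h n x) \<longlonglongrightarrow> f x"
    unfolding measurable_on_def by auto
  \<comment> \<open>Clipping to [-F, F] and a cutoff equal to 1 up to radius \<open>L\<close> and 0
    beyond L + 1 give a common dominating function without changing the limit.\<close>
  define g where "g n x = max (-F) (min F (h n x)) * max 0 (min 1 (L + 1 - norm x))" for n :: nat and x
  have g_cont: "continuous_on UNIV (g n)" for n
    unfolding g_def by (intro continuous_intros h)
  then have [measurable]: "g n \<in> borel_measurable borel" for n by (rule borel_measurable_continuous_onI)
  have g_bd: "\<bar>g n x\<bar> \<le> F" for n x
  proof -
    have "\<bar>g n x\<bar> \<le> F * 1" unfolding g_def abs_mult using F0 by (intro mult_mono) auto
    then show ?thesis by simp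
  qed
  have g_supp: "g n x = 0" if "L + 1 < norm x" for n x using that by (simp add: g_def)
  have g_lim: "(\<lambda>n. g n x) \<longlonglongrightarrow> f x" if "x \<notin> Z" for x
  proof -
    have "(\<lambda>n. g n x) \<longlonglongrightarrow> max (-F) (min F (f x)) * max 0 (min 1 (L + 1 - norm x))"
      unfolding g_def by (intro tendsto_intros lim that)
    also have "max (-F) (min F (f x)) * max 0 (min 1 (L + 1 - norm x)) = f x"
      using F[of x] L[of x] by (cases "L < norm x") (auto simp: max_def min_def)
    finally show ?thesis .
  qed
  have "(\<lambda>n. nrm (\<lambda>x. ennreal \<bar>f x - g n x\<bar>)) \<longlonglongrightarrow> 0"
  proof (rule mixnorm_aux_dominated[OF P _ _ _ _ setis])
    show "ennreal \<bar>f x - g m x\<bar> \<le> ennreal (2 * F) * indicator (cball 0 (L + 1)) x" for m x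
      using F[of x] g_bd[of m x] L[of x] g_supp[of x m] by (auto simp: indicator_def intro!: ennreal_leI)
    show "nrm (\<lambda>x. ennreal (2 * F) * indicator (cball 0 (L + 1)) x) < top"
      by (rule mixnorm_finite_compact_support[where C="2*F" and L="L+1"]) (use F0 in \<open>auto simp: indicator_def\<close>)
    have "AE x in lebesgue. x \<notin> Z" using Z by (simp add: negligible_iff_null_sets AE_not_in)
    then have "AE x in lborel. x \<notin> Z" by (simp add: AE_completion_iff)
    then show "AE x in lborel. (\<lambda>m. ennreal \<bar>f x - g m x\<bar>) \<longlonglongrightarrow> 0"
    proof eventually_elim
      case (elim x)
      have "(\<lambda>m. ennreal \<bar>f x - g m x\<bar>) \<longlonglongrightarrow> ennreal \<bar>f x - f x\<bar>"
        by (intro tendsto_intros g_lim elim)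
      then show ?case by simp
    qed
    show "(\<lambda>x. ennreal (2 * F) * indicator (cball 0 (L + 1)) x) \<in> borel_measurable borel"
      by (intro borel_measurable_times_ennreal borel_measurable_indicator) auto
  qed auto
  then have "\<forall>\<^sub>F n in sequentially. nrm (\<lambda>x. ennreal \<bar>f x - g n x\<bar>) < e"
    using \<open>0 < e\<close> by (rule order_tendstoD(2))
  from eventually_happens'[OF sequentially_bot this]
  obtain n where "nrm (\<lambda>x. ennreal \<bar>f x - g n x\<bar>) < e" by (elim exE)
  then show ?thesis using g_cont g_bd g_supp by blast
qed

lemma approx_compact_support:
  fixes f :: "real^'n \<Rightarrow> real"
  assumes [measurable]: "f \<in> borel_measurable borel" and fin: "nrm (\<lambda>x. ennreal \<bar>f x\<bar>) < top" and "0 < e"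
  shows "\<exists>g F L. continuous_on UNIV g \<and> (\<forall>x. \<bar>g x\<bar> \<le> F) \<and> (\<forall>x. L < norm x \<longrightarrow> g x = 0)
    \<and> nrm (\<lambda>x. ennreal \<bar>f x - g x\<bar>) \<le> 2 ^ length is * (ennreal e + ennreal e)"
proof -
  \<comment> \<open>Truncation in value and in space at once; the error is dominated by
    \<bar>f\<bar>, which has finite norm.\<close>
  define h where "h m x = (if \<bar>f x\<bar> \<le> real m \<and> norm x \<le> real m then f x else 0)" for m :: nat and x
  have [measurable]: "h m \<in> borel_measurable borel" for m unfolding h_def by measurable
  have "(\<lambda>m. nrm (\<lambda>x. ennreal \<bar>f x - h m x\<bar>)) \<longlonglongrightarrow> 0"
  proof (rule mixnorm_aux_dominated[OF P _ _ _ _ setis fin])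
    show "AE x in lborel. (\<lambda>m. ennreal \<bar>f x - h m x\<bar>) \<longlonglongrightarrow> 0"
    proof (intro AE_I2 tendsto_eventually)
      fix x :: "real^'n"
      have "\<forall>\<^sub>F m in sequentially. max \<bar>f x\<bar> (norm x) \<le> real m"
        using filterlim_real_sequentially unfolding filterlim_at_top by blast
      then show "\<forall>\<^sub>F m in sequentially. ennreal \<bar>f x - h m x\<bar> = 0"
        by eventually_elim (simp add: h_def)
    qed
  qed (auto simp: h_def)
  then have "\<forall>\<^sub>F m in sequentially. nrm (\<lambda>x. ennreal \<bar>f x - h m x\<bar>) < ennreal e"
    using \<open>0 < e\<close> by (intro order_tendstoD(2)) auto
  from eventually_happens'[OF sequentially_bot this]
  obtain m where m: "nrm (\<lambda>x. ennreal \<bar>f x - h m x\<bar>) < ennreal e" by (elim exE)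
  obtain g where g: "continuous_on UNIV g" "\<forall>x. \<bar>g x\<bar> \<le> real m" "\<forall>x. real m + 1 < norm x \<longrightarrow> g x = 0"
    "nrm (\<lambda>x. ennreal \<bar>h m x - g x\<bar>) < ennreal e"
  proof -
    have "\<exists>g. continuous_on UNIV g \<and> (\<forall>x. \<bar>g x\<bar> \<le> real m) \<and> (\<forall>x. real m + 1 < norm x \<longrightarrow> g x = 0) \<and>
        nrm (\<lambda>x. ennreal \<bar>h m x - g x\<bar>) < ennreal e"
      by (rule approx_compact_support_bounded) (use \<open>0 < e\<close> in \<open>auto simp: h_def\<close>)
    then show ?thesis by (elim exE conjE) (rule that)
  qed
  have [measurable]: "g \<in> borel_measurable borel" using g(1) by (rule borel_measurable_continuous_onI)
  have "nrm (\<lambda>x. ennreal \<bar>f x - g x\<bar>) \<le> nrm (\<lambda>x. ennreal \<bar>f x - h m x\<bar> + ennreal \<bar>h m x - g x\<bar>)"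
    by (intro mixnorm_mono) (simp flip: ennreal_plus)
  also have "\<dots> \<le> 2 ^ length is * (nrm (\<lambda>x. ennreal \<bar>f x - h m x\<bar>) + nrm (\<lambda>x. ennreal \<bar>h m x - g x\<bar>))"
    by (rule mixnorm_add) auto
  also have "\<dots> \<le> 2 ^ length is * (ennreal e + ennreal e)"
    using m g(4) by (intro mult_left_mono add_mono) auto
  finally show ?thesis using g by blast
qed

section \<open>Convergence of the oscillation for a Borel kernel with bounded periodization\<close>

context
  fixes X :: "real^'n \<Rightarrow> ennreal" and M :: real
  assumes X [measurable]: "X \<in> borel_measurable borel"
    and M: "\<And>x. (\<integral>\<^sup>+t. X (x - vec_floor t) \<partial>lborel) \<le> ennreal M" and M0: "0 < M"
    and N: "(\<integral>\<^sup>+t. X t \<partial>lborel) < top"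
begin

lemma osc_op_tendsto_compact_support:
  fixes g :: "real^'n \<Rightarrow> real"
  assumes g: "continuous_on UNIV g" and F: "\<And>x. \<bar>g x\<bar> \<le> F" and L: "\<And>x. L < norm x \<Longrightarrow> g x = 0"
  shows "((\<lambda>w. nrm (osc_op X w g)) \<longlongrightarrow> 0) at_top"
proof -
  have [measurable]: "g \<in> borel_measurable borel" using g by (rule borel_measurable_continuous_onI)
  have F0: "0 \<le> F" using F[of 0] by linarith
  define D :: "real^'n \<Rightarrow> ennreal" where "D = indicator (cball 0 (L + 1))"
  have [measurable]: "D \<in> borel_measurable borel" unfolding D_def by (rule borel_measurable_indicator) simp
  define XR where "XR = (\<lambda>(m::nat) v. X v * indicator {v. real m < norm v} v)"
  have [measurable]: "XR m \<in> borel_measurable borel" for m unfolding XR_def by measurable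
  define c where "c m = ennreal (M powr (1 - 1 / q)) * epowr (\<integral>\<^sup>+t. XR m t \<partial>lborel) (1 / q)" for m
  define a1 where "a1 = nrm D"
  define a2 where "a2 = nrm (\<lambda>t. ennreal \<bar>g t\<bar>)"
  have a1: "a1 < top" unfolding a1_def
    by (rule mixnorm_finite_compact_support[where C=1 and L="L+1"]) (auto simp: D_def indicator_def)
  have a2: "a2 < top" unfolding a2_def
    by (rule mixnorm_finite_compact_support[where C=F and L=L]) (auto simp: F F0 L ennreal_leI)
  \<comment> \<open>One index \<open>m\<close> governs both the modulus 1/(m+1) and the tail radius
    \<open>m\<close>. The two terms with \<open>c m\<close> come from the tail acting on g(t) and on
    g(x).\<close>
  define s where "s m = 2 ^ length is * (ennreal M * a1 * ennreal (1 / Suc m) + 2 ^ length is * (a2 * c m + ennreal F * a1 * c m))" for m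
  have MR: "(\<integral>\<^sup>+t. XR m (x - vec_floor t) \<partial>lborel) \<le> ennreal M" for m x
    using M[of x] by (rule order_trans[rotated]) (auto intro!: nn_integral_mono simp: XR_def indicator_def)
  have bd: "\<forall>\<^sub>F w in at_top. nrm (osc_op X w g) \<le> s m" for m
  proof -
    obtain \<delta> where \<delta>: "0 < \<delta>" "\<delta> \<le> 1" "\<And>x t. dist x t < \<delta> \<Longrightarrow> \<bar>g t - g x\<bar> \<le> 1 / Suc m"
      by (rule uniform_modulus_compact_support[where L=L and \<eta>="1 / Suc m", OF g]) (rule L, assumption, simp, rule that)
    have "\<forall>\<^sub>F w in at_top. max (real CARD('n) * 2) ((real m + real CARD('n)) / \<delta>) < w"
      by (rule eventually_gt_at_top)
    then show ?thesis
    proof eventually_elim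
      case (elim w)
      then have w: "real CARD('n) * 2 < w" "real m + real CARD('n) < w * \<delta>"
        using \<delta> by (auto simp: field_simps)
      have w0: "0 < w" using w by (smt (verit) of_nat_0_le_iff mult_nonneg_nonneg)
      have "nrm (osc_op X w g) \<le> nrm (\<lambda>x. ennreal (M * (1 / Suc m)) * D x +
         (kant_op (XR m) w (\<lambda>t. ennreal \<bar>g t\<bar>) x + ennreal F * kant_op (cell_kernel (XR m)) w D x))"
        unfolding D_def XR_def
        by (intro mixnorm_mono osc_op_compact_support_le[where \<delta>=\<delta>] X M F L w \<delta>) auto
      also have "\<dots> \<le> 2 ^ length is * (nrm (\<lambda>x. ennreal (M * (1 / Suc m)) * D x) +
           2 ^ length is * (nrm (kant_op (XR m) w (\<lambda>t. ennreal \<bar>g t\<bar>)) + nrm (\<lambda>x. ennreal F * kant_op (cell_kernel (XR m)) w D x)))"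
        by (intro order_trans[OF mixnorm_add] mult_left_mono add_left_mono) auto
      also have "\<dots> = 2 ^ length is * (ennreal (M * (1 / Suc m)) * a1 +
           2 ^ length is * (nrm (kant_op (XR m) w (\<lambda>t. ennreal \<bar>g t\<bar>)) + ennreal F * nrm (kant_op (cell_kernel (XR m)) w D)))"
        by (simp add: mixnorm_cmult a1_def)
      also have "\<dots> \<le> 2 ^ length is * (ennreal (M * (1 / Suc m)) * a1 + 2 ^ length is * (c m * a2 + ennreal F * (c m * a1)))"
      proof (intro mult_left_mono add_left_mono add_mono)
        show "nrm (kant_op (XR m) w (\<lambda>t. ennreal \<bar>g t\<bar>)) \<le> c m * a2"
          unfolding c_def a2_def by (intro mixnorm_kant_op_le P srt dist setis MR M0 w0) auto
        have "nrm (kant_op (cell_kernel (XR m)) w D) \<le> ennreal (M powr (1 - 1 / q)) * epowr (\<integral>\<^sup>+t. cell_kernel (XR m) t \<partial>lborel) (1 / q) * nrm D"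
          by (intro mixnorm_kant_op_le P srt dist setis M0 w0) (auto simp: nn_integral_cell_kernel_shift MR)
        then show "nrm (kant_op (cell_kernel (XR m)) w D) \<le> c m * a1"
          by (simp add: nn_integral_cell_kernel c_def a1_def)
      qed auto
      also have "\<dots> = s m"
        by (simp only: s_def mult_ac ennreal_mult''[of "1 / Suc m" M, OF divide_nonneg_nonneg[OF zero_le_one of_nat_0_le_iff]])
      finally show ?case .
    qed
  qed
  \<comment> \<open>Integrability of \<open>X\<close> makes the tail mass vanish. Hence
    \<open>c\<close> tends to 0, since the mass carries a positive exponent.\<close>
  have "(\<lambda>m. \<integral>\<^sup>+t. XR m t \<partial>lborel) \<longlonglongrightarrow> (\<integral>\<^sup>+t. 0 \<partial>(lborel :: (real^'n) measure))"
  proof (rule nn_integral_dominated_convergence[where w=X])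
    show "AE t in lborel. (\<lambda>m. XR m t) \<longlonglongrightarrow> 0"
    proof (intro AE_I2 tendsto_eventually)
      fix t :: "real^'n"
      have "\<forall>\<^sub>F m in sequentially. norm t \<le> real m"
        using filterlim_real_sequentially unfolding filterlim_at_top by blast
      then show "\<forall>\<^sub>F m in sequentially. XR m t = 0"
        by eventually_elim (simp add: XR_def)
    qed
  qed (use N in \<open>auto simp: XR_def indicator_def\<close>)
  then have "c \<longlonglongrightarrow> 0" unfolding c_def[abs_def]
    using last_exponent_pos by (intro tendsto_mult_finite_0 tendsto_epowr_0) auto
  then have "s \<longlonglongrightarrow> 0" unfolding s_def[abs_def]
    using a1 a2 by (intro tendsto_mult_finite_0 tendsto_add_0 LIMSEQ_ennreal_inverse_Suc power2_less_top) (auto simp: ennreal_mult_less_top)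
  with bd show ?thesis by (rule tendsto_0_ennreal_approx)
qed

text \<open>Density argument: the operator bound uniform in \<open>w\<close> controls the action on
  f - g, and \<open>M\<close> controls the multiplication term.\<close>

lemma osc_op_tendsto:
  fixes f :: "real^'n \<Rightarrow> real"
  assumes [measurable]: "f \<in> borel_measurable borel" and fin: "nrm (\<lambda>x. ennreal \<bar>f x\<bar>) < top"
  shows "((\<lambda>w. nrm (osc_op X w f)) \<longlongrightarrow> 0) at_top"
proof -
  define K where "K = (2::ennreal) ^ length is"
  define C where "C = ennreal (M powr (1 - 1 / q)) * epowr (\<integral>\<^sup>+t. X t \<partial>lborel) (1 / q)"
  have K: "K < top" by (simp add: K_def power2_less_top)
  have C: "C < top" using N by (simp add: C_def ennreal_mult_less_top)
  define e where "e m = ennreal (1 / real (Suc m))" for m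
  define E where "E m = K * (e m + e m)" for m
  define s where "s m = K * (e m + K * (C * E m + ennreal M * E m))" for m
  have bd: "\<forall>\<^sub>F w in at_top. nrm (osc_op X w f) \<le> s m" for m
  proof -
    have "0 < 1 / real (Suc m)" by simp
    from approx_compact_support[OF assms this]
    obtain g F L where g: "continuous_on UNIV g" "\<forall>x. \<bar>g x\<bar> \<le> F" "\<forall>x. L < norm x \<longrightarrow> g x = 0"
      and d: "nrm (\<lambda>x. ennreal \<bar>f x - g x\<bar>) \<le> E m"
      unfolding E_def K_def e_def by (elim exE conjE)
    have [measurable]: "g \<in> borel_measurable borel" using g(1) by (rule borel_measurable_continuous_onI)
    have "((\<lambda>w. nrm (osc_op X w g)) \<longlongrightarrow> 0) at_top"
      by (rule osc_op_tendsto_compact_support[where F=F and L=L]) (use g in auto)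
    then have "\<forall>\<^sub>F w in at_top. nrm (osc_op X w g) < e m"
      by (rule order_tendstoD(2)) (simp add: e_def)
    then show ?thesis using eventually_gt_at_top[of 0]
    proof eventually_elim
      case (elim w)
      have "nrm (osc_op X w f) \<le> nrm (\<lambda>x. osc_op X w g x + (kant_op X w (\<lambda>t. ennreal \<bar>f t - g t\<bar>) x + ennreal M * ennreal \<bar>f x - g x\<bar>))"
        using elim by (intro mixnorm_mono osc_op_le M) auto
      also have "\<dots> \<le> K * (nrm (osc_op X w g) + K * (nrm (kant_op X w (\<lambda>t. ennreal \<bar>f t - g t\<bar>)) + nrm (\<lambda>x. ennreal M * ennreal \<bar>f x - g x\<bar>)))"
        unfolding K_def by (intro order_trans[OF mixnorm_add] mult_left_mono add_left_mono) auto
      also have "\<dots> \<le> K * (e m + K * (C * E m + ennreal M * E m))"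
      proof (intro mult_left_mono add_mono)
        have "nrm (kant_op X w (\<lambda>t. ennreal \<bar>f t - g t\<bar>)) \<le> C * nrm (\<lambda>t. ennreal \<bar>f t - g t\<bar>)"
          unfolding C_def using elim by (intro mixnorm_kant_op_le P srt dist setis M M0) auto
        also have "\<dots> \<le> C * E m" by (intro mult_left_mono d) auto
        finally show "nrm (kant_op X w (\<lambda>t. ennreal \<bar>f t - g t\<bar>)) \<le> C * E m" .
        show "nrm (\<lambda>x. ennreal M * ennreal \<bar>f x - g x\<bar>) \<le> ennreal M * E m"
          by (subst mixnorm_cmult) (auto intro: mult_left_mono d)
      qed (use elim in auto)
      finally show ?case by (simp add: s_def)
    qed
  qed
  have e: "e \<longlonglongrightarrow> 0" unfolding e_def[abs_def] by (rule LIMSEQ_ennreal_inverse_Suc)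
  then have "E \<longlonglongrightarrow> 0" unfolding E_def[abs_def] by (intro tendsto_mult_finite_0 tendsto_add_0 K)
  with e have "s \<longlonglongrightarrow> 0" unfolding s_def[abs_def]
    by (intro tendsto_mult_finite_0 tendsto_add_0 K C) auto
  with bd show ?thesis by (rule tendsto_0_ennreal_approx)
qed

end

end

section \<open>The Kantorovich operator\<close>

lemma Zn_eq_range: "(Zn :: (real^'n) set) = range (\<lambda>g. \<chi> i. of_int (g i))"
proof (intro set_eqI iffI)
  fix k :: "real^'n" assume "k \<in> Zn"
  then have eq: "k = (\<chi> i. of_int \<lfloor>k $ i\<rfloor>)" by (simp add: Zn_def vec_eq_iff of_int_floor)
  show "k \<in> range (\<lambda>g. \<chi> i. of_int (g i))"
    by (rule range_eqI[where x="\<lambda>i. \<lfloor>k $ i\<rfloor>"]) (rule eq)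
qed (auto simp: Zn_def)

lemma countable_Zn: "countable (Zn :: (real^'n::finite) set)"
  unfolding Zn_eq_range by (intro countable_image) simp

lemma AE_lborel_affine:
  fixes Q :: "real^'n \<Rightarrow> bool"
  assumes "AE v in lborel. Q v" "0 < w"
  shows "AE x in lborel. Q (w *\<^sub>R x - c)"
proof -
  obtain N where N: "{y. \<not> Q y} \<subseteq> N" "emeasure lborel N = 0" and [measurable]: "N \<in> sets borel"
    using assms(1) by (auto elim!: AE_E)
  have "ennreal (w ^ CARD('n)) * (\<integral>\<^sup>+x. indicator N (w *\<^sub>R x - c) \<partial>(lborel::(real^'n) measure)) = (\<integral>\<^sup>+x. indicator N (x + - c) \<partial>lborel)"
    using nn_integral_lborel_scale[of "\<lambda>x. indicator N (x - c)" w] \<open>0 < w\<close> by simp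
  also have "\<dots> = 0" using N(2) by (subst nn_integral_lborel_shift) auto
  finally have "(\<integral>\<^sup>+x. indicator N (w *\<^sub>R x - c) \<partial>(lborel::(real^'n) measure)) = 0"
    using \<open>0 < w\<close> by simp
  then have "AE x in lborel. indicator N (w *\<^sub>R x - c) = (0::ennreal)"
    by (subst (asm) nn_integral_0_iff_AE) auto
  then show ?thesis by eventually_elim (use N(1) in \<open>auto simp: indicator_def split: if_splits\<close>)
qed

text \<open>The integral is the lattice sum of \<open>c\<close>, as cells have measure 1. An
  enumeration of the lattice exhausts it by finite sets, and monotone convergence passes their bound
  on.\<close>

lemma nn_integral_vec_floor_le:
  fixes c :: "real^'n \<Rightarrow> ennreal"
  assumes [measurable]: "c \<in> borel_measurable borel"
    and A: "\<And>F. finite F \<Longrightarrow> F \<subseteq> Zn \<Longrightarrow> (\<Sum>k\<in>F. c k) \<le> A"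
  shows "(\<integral>\<^sup>+t. c (vec_floor t) \<partial>lborel) \<le> A"
proof -
  define F where "F N = from_nat_into (Zn :: (real^'n) set) ` {..<N}" for N
  have ne: "(Zn :: (real^'n) set) \<noteq> {}" using vec_floor_in_Zn by blast
  have F: "finite (F N)" "F N \<subseteq> Zn" "mono F" for N
    using from_nat_into[OF ne] by (auto simp: F_def mono_def)
  define g where "g N t = (\<Sum>k\<in>F N. c k * indicator {t. vec_floor t = k} t)" for N t
  have g: "g N t = (if vec_floor t \<in> F N then c (vec_floor t) else 0)" for N t
  proof -
    have "g N t = (\<Sum>k\<in>F N. if vec_floor t = k then c k else 0)"
      unfolding g_def by (intro sum.cong) (auto simp: indicator_def)
    then show ?thesis using F(1)[of N] by (simp add: sum.delta)
  qed
  have "incseq g"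
  proof (intro incseq_SucI le_funI)
    fix N t
    have "F N \<subseteq> F (Suc N)" using F(3) by (auto simp: mono_def)
    then show "g N t \<le> g (Suc N) t" by (auto simp: g)
  qed
  have sup: "(SUP N. g N t) = c (vec_floor t)" for t
  proof (rule antisym)
    show "(SUP N. g N t) \<le> c (vec_floor t)" by (rule SUP_least) (simp add: g)
    obtain m where "from_nat_into Zn m = vec_floor t"
      using from_nat_into_surj[OF countable_Zn vec_floor_in_Zn] by blast
    then have "vec_floor t \<in> F (Suc m)" by (auto simp: F_def intro!: image_eqI[of _ _ m])
    then have "c (vec_floor t) = g (Suc m) t" by (simp add: g)
    also have "\<dots> \<le> (SUP N. g N t)" by (rule SUP_upper) simp
    finally show "c (vec_floor t) \<le> (SUP N. g N t)" .
  qed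
  have [measurable]: "g N \<in> borel_measurable borel" for N
    unfolding g_def[abs_def] by measurable
  have "(\<integral>\<^sup>+t. g N t \<partial>lborel) \<le> A" for N
  proof -
    have "(\<integral>\<^sup>+t. g N t \<partial>lborel) = (\<Sum>k\<in>F N. c k * emeasure lborel {t. vec_floor t = k})"
      unfolding g_def by (subst nn_integral_sum) (auto simp: nn_integral_cmult)
    also have "\<dots> = (\<Sum>k\<in>F N. c k)"
      using F(2)[of N] by (intro sum.cong) (auto simp: emeasure_unit_cell subset_iff)
    also have "\<dots> \<le> A" using A F by blast
    finally show ?thesis .
  qed
  moreover have "(\<integral>\<^sup>+t. c (vec_floor t) \<partial>lborel) = (SUP N. \<integral>\<^sup>+t. g N t \<partial>lborel)"
    unfolding sup[symmetric] using \<open>incseq g\<close> by (intro nn_integral_monotone_convergence_SUP) auto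
  ultimately show ?thesis by (simp add: SUP_least)
qed

text \<open>The closed cells of the operator overlap on their boundaries; discarding these null sets
  makes them the disjoint level sets of the floor.\<close>

lemma cbox_AE_vec_floor:
  fixes k :: "real^'n"
  assumes "0 < w" "k \<in> Zn"
  shows "AE t in lborel. t \<in> cbox ((1 / w) *\<^sub>R k) ((1 / w) *\<^sub>R (k + 1)) \<longrightarrow> vec_floor (w *\<^sub>R t) = k"
proof -
  let ?a = "(1 / w) *\<^sub>R k" and ?b = "(1 / w) *\<^sub>R (k + 1)"
  have "AE t in lebesgue. t \<notin> cbox ?a ?b - box ?a ?b"
    by (rule AE_not_in) (use negligible_frontier_interval[of ?a ?b] in \<open>simp only: negligible_iff_null_sets\<close>)
  then have "AE t in lborel. t \<notin> cbox ?a ?b - box ?a ?b" by (simp add: AE_completion_iff)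
  then show ?thesis
  proof eventually_elim
    case (elim t)
    show ?case
    proof
      assume "t \<in> cbox ?a ?b"
      with elim have "t \<in> box ?a ?b" by blast
      then have "k $ i < w * t $ i \<and> w * t $ i < k $ i + 1" for i
        using \<open>0 < w\<close> by (simp add: mem_box_cart field_simps)
      moreover have "\<exists>m. k $ i = of_int m" for i using assms(2) by (auto simp: Zn_def elim!: Ints_cases)
      ultimately have "of_int \<lfloor>w * t $ i\<rfloor> = k $ i" for i
        by (metis floor_unique less_imp_le)
      then show "vec_floor (w *\<^sub>R t) = k" by (simp add: vec_eq_iff)
    qed
  qed
qed

lemma sum_cells_le_kant_op:
  fixes X h :: "real^'n \<Rightarrow> ennreal"
  assumes [measurable]: "X \<in> borel_measurable borel" "h \<in> borel_measurable borel" and "0 < w" "finite F" "F \<subseteq> Zn"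
  shows "(\<Sum>k\<in>F. X (w *\<^sub>R x - k) * (ennreal (w ^ CARD('n)) * (\<integral>\<^sup>+t. indicator (cbox ((1 / w) *\<^sub>R k) ((1 / w) *\<^sub>R (k + 1))) t * h t \<partial>lborel)))
     \<le> kant_op X w h x"
proof -
  have [measurable]: "{t. vec_floor (w *\<^sub>R t) = k} \<in> sets borel" for k :: "real^'n"
  proof -
    have "(\<lambda>t. vec_floor (w *\<^sub>R t)) -` {k} \<inter> space borel \<in> sets borel"
      by (rule measurable_sets[where A=borel]) auto
    then show ?thesis by (simp add: vimage_def)
  qed
  let ?I = "\<lambda>k t. indicator {t. vec_floor (w *\<^sub>R t) = k} t :: ennreal"
  have "(\<Sum>k\<in>F. X (w *\<^sub>R x - k) * (ennreal (w ^ CARD('n)) * (\<integral>\<^sup>+t. indicator (cbox ((1 / w) *\<^sub>R k) ((1 / w) *\<^sub>R (k + 1))) t * h t \<partial>lborel)))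
     \<le> (\<Sum>k\<in>F. X (w *\<^sub>R x - k) * (ennreal (w ^ CARD('n)) * (\<integral>\<^sup>+t. ?I k t * h t \<partial>lborel)))"
  proof (intro sum_mono mult_left_mono nn_integral_mono_AE)
    fix k assume "k \<in> F"
    then have "k \<in> Zn" using assms by blast
    from cbox_AE_vec_floor[OF \<open>0 < w\<close> this]
    show "AE t in lborel. indicator (cbox ((1 / w) *\<^sub>R k) ((1 / w) *\<^sub>R (k + 1))) t * h t \<le> ?I k t * h t"
      by eventually_elim (auto simp: indicator_def)
  qed auto
  also have "\<dots> = (\<Sum>k\<in>F. ennreal (w ^ CARD('n)) * (\<integral>\<^sup>+t. X (w *\<^sub>R x - k) * (?I k t * h t) \<partial>lborel))"
    by (subst nn_integral_cmult) (auto intro!: sum.cong mult.left_commute)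
  also have "\<dots> = ennreal (w ^ CARD('n)) * (\<integral>\<^sup>+t. (\<Sum>k\<in>F. X (w *\<^sub>R x - k) * (?I k t * h t)) \<partial>lborel)"
    by (subst nn_integral_sum) (auto simp: sum_distrib_left)
  also have "\<dots> \<le> kant_op X w h x"
    unfolding kant_op_def
  proof (intro mult_left_mono nn_integral_mono)
    fix t
    have "(\<Sum>k\<in>F. X (w *\<^sub>R x - k) * (?I k t * h t)) = (\<Sum>k\<in>F. if vec_floor (w *\<^sub>R t) = k then X (w *\<^sub>R x - k) * h t else 0)"
      by (intro sum.cong) (auto simp: indicator_def)
    also have "\<dots> \<le> X (w *\<^sub>R x - vec_floor (w *\<^sub>R t)) * h t"
      using \<open>finite F\<close> by (simp add: sum.delta)
    finally show "(\<Sum>k\<in>F. X (w *\<^sub>R x - k) * (?I k t * h t)) \<le> X (w *\<^sub>R x - vec_floor (w *\<^sub>R t)) * h t" .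
  qed auto
  finally show ?thesis .
qed

text \<open>Finiteness of the integral of \<bar>f - c\<bar> over the cell makes f integrable there,
  so the Bochner integral is a genuine value and not the default 0.\<close>

lemma average_diff_le:
  fixes f :: "real^'n \<Rightarrow> real" and k :: "real^'n"
  assumes [measurable]: "f \<in> borel_measurable lebesgue" and "0 < w"
  defines "I \<equiv> cbox ((1 / w) *\<^sub>R k) ((1 / w) *\<^sub>R (k + 1))"
  assumes fin: "(\<integral>\<^sup>+t. indicator I t * ennreal \<bar>f t - c\<bar> \<partial>lborel) < top"
  shows "ennreal \<bar>w ^ CARD('n) * set_lebesgue_integral lebesgue I f - c\<bar>
     \<le> ennreal (w ^ CARD('n)) * (\<integral>\<^sup>+t. indicator I t * ennreal \<bar>f t - c\<bar> \<partial>lborel)"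
proof -
  have I [measurable]: "I \<in> sets lebesgue" by (simp add: I_def)
  have measI: "measure lebesgue I = (1 / w) ^ CARD('n)"
    using \<open>0 < w\<close> by (simp add: I_def measure_lborel_cbox_eq inner_add_left inner_one_Basis field_simps del: power_one_over)
  have ifin: "emeasure lebesgue I < \<infinity>" by (simp add: I_def emeasure_lborel_cbox_eq)
  have eq: "(\<integral>\<^sup>+t. norm (indicator I t *\<^sub>R (f t - c)) \<partial>lebesgue) = (\<integral>\<^sup>+t. indicator I t * ennreal \<bar>f t - c\<bar> \<partial>lborel)"
    unfolding nn_integral_completion by (intro nn_integral_cong) (auto simp: indicator_def)
  have int: "integrable lebesgue (\<lambda>t. indicator I t *\<^sub>R (f t - c))"
    using fin eq by (intro integrableI_bounded) auto
  have intc: "integrable lebesgue (\<lambda>t. indicator I t *\<^sub>R c)"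
    using ifin by (intro integrable_scaleR_left) (auto simp: integrable_indicator_iff)
  have "set_lebesgue_integral lebesgue I f = (\<integral>t. indicator I t *\<^sub>R (f t - c) + indicator I t *\<^sub>R c \<partial>lebesgue)"
    unfolding set_lebesgue_integral_def by (intro Bochner_Integration.integral_cong) (auto simp: algebra_simps)
  also have "\<dots> = (\<integral>t. indicator I t *\<^sub>R (f t - c) \<partial>lebesgue) + (\<integral>t. indicator I t *\<^sub>R c \<partial>lebesgue)"
    by (rule Bochner_Integration.integral_add[OF int intc])
  also have "(\<integral>t. indicator I t *\<^sub>R c \<partial>lebesgue) = (1 / w) ^ CARD('n) * c"
    using ifin measI by (subst Bochner_Integration.integral_scaleR_left) (auto simp: integrable_indicator_iff)
  finally have "w ^ CARD('n) * set_lebesgue_integral lebesgue I f - c = w ^ CARD('n) * (\<integral>t. indicator I t *\<^sub>R (f t - c) \<partial>lebesgue)"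
    using \<open>0 < w\<close> by (simp add: distrib_left power_one_over mult.assoc[symmetric])
  then have "ennreal \<bar>w ^ CARD('n) * set_lebesgue_integral lebesgue I f - c\<bar>
     = ennreal (w ^ CARD('n)) * ennreal (norm (\<integral>t. indicator I t *\<^sub>R (f t - c) \<partial>lebesgue))"
    using \<open>0 < w\<close> by (simp add: abs_mult ennreal_mult')
  also have "\<dots> \<le> ennreal (w ^ CARD('n)) * (\<integral>\<^sup>+t. norm (indicator I t *\<^sub>R (f t - c)) \<partial>lebesgue)"
    by (intro mult_left_mono integral_norm_bound_ennreal int) auto
  finally show ?thesis unfolding eq .
qed

text \<open>A finite bound \<open>A\<close> on all partial sums yields absolute summability, so
  \<open>infsum\<close> is the true sum rather than its default 0; an infinite \<open>A\<close>
  leaves nothing to prove.\<close>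

lemma kantorovich_diff_le:
  fixes f \<chi>f :: "real^'n \<Rightarrow> real" and x :: "real^'n"
  assumes f: "f \<in> borel_measurable lebesgue" and "0 < w"
    and sum1: "((\<lambda>k. \<chi>f (w *\<^sub>R x - k)) has_sum 1) Zn"
  defines "T \<equiv> (\<lambda>k. ennreal \<bar>\<chi>f (w *\<^sub>R x - k)\<bar> * (ennreal (w ^ CARD('n)) *
     (\<integral>\<^sup>+t. indicator (cbox ((1 / w) *\<^sub>R k) ((1 / w) *\<^sub>R (k + 1))) t * ennreal \<bar>f t - f x\<bar> \<partial>lborel)))"
  assumes A: "\<And>F. finite F \<Longrightarrow> F \<subseteq> Zn \<Longrightarrow> (\<Sum>k\<in>F. T k) \<le> A"
  shows "ennreal \<bar>kantorovich \<chi>f w f x - f x\<bar> \<le> A"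
proof (cases A)
  case (real r)
  define a where "a k = \<chi>f (w *\<^sub>R x - k) * w ^ CARD('n) *
      set_lebesgue_integral lebesgue (cbox ((1 / w) *\<^sub>R k) ((1 / w) *\<^sub>R (k + 1))) f" for k
  define d where "d k = a k - \<chi>f (w *\<^sub>R x - k) * f x" for k
  have dT: "ennreal \<bar>d k\<bar> \<le> T k" if "k \<in> Zn" for k
  \<comment> \<open>If the kernel value vanishes, \<open>T k\<close> says nothing about the cell
    integral, which may be infinite, but then \<open>d k\<close> is 0.\<close>
  proof (cases "\<chi>f (w *\<^sub>R x - k) = 0")
    case False
    let ?J = "\<integral>\<^sup>+t. indicator (cbox ((1 / w) *\<^sub>R k) ((1 / w) *\<^sub>R (k + 1))) t * ennreal \<bar>f t - f x\<bar> \<partial>lborel"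
    have "T k \<le> ennreal r" using A[of "{k}"] that real by simp
    then have "T k < top" by (rule order.strict_trans1) simp
    then have "?J < top"
      using False \<open>0 < w\<close> unfolding T_def by (auto simp: ennreal_mult_less_top)
    from average_diff_le[OF f \<open>0 < w\<close> this]
    have "ennreal \<bar>\<chi>f (w *\<^sub>R x - k)\<bar> * ennreal \<bar>w ^ CARD('n) * set_lebesgue_integral lebesgue (cbox ((1 / w) *\<^sub>R k) ((1 / w) *\<^sub>R (k + 1))) f - f x\<bar> \<le> T k"
      unfolding T_def by (intro mult_left_mono) auto
    moreover have "d k = \<chi>f (w *\<^sub>R x - k) * (w ^ CARD('n) * set_lebesgue_integral lebesgue (cbox ((1 / w) *\<^sub>R k) ((1 / w) *\<^sub>R (k + 1))) f - f x)"
      by (simp add: d_def a_def right_diff_distrib mult.assoc)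
    ultimately show ?thesis by (simp add: abs_mult ennreal_mult)
  qed (simp add: d_def a_def)
  have fin: "(\<Sum>k\<in>F. \<bar>d k\<bar>) \<le> r" if "finite F" "F \<subseteq> Zn" for F
  proof -
    have "ennreal (\<Sum>k\<in>F. \<bar>d k\<bar>) = (\<Sum>k\<in>F. ennreal \<bar>d k\<bar>)" by simp
    also have "\<dots> \<le> (\<Sum>k\<in>F. T k)" using that by (intro sum_mono dT) auto
    also have "\<dots> \<le> ennreal r" using A[OF that] real by simp
    finally show ?thesis using real by simp
  qed
  have abs: "(\<lambda>k. norm (d k)) summable_on Zn"
    unfolding abs_summable_iff_bdd_above using fin by (auto simp: bdd_above_def)
  then have d: "d summable_on Zn" by (rule abs_summable_summable)
  have "\<bar>infsum d Zn\<bar> \<le> infsum (\<lambda>k. norm (d k)) Zn" using norm_infsum_bound[OF abs] by simp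
  also have "\<dots> \<le> r" using abs fin by (intro infsum_le_finite_sums) auto
  finally have "\<bar>infsum d Zn\<bar> \<le> r" .
  moreover have "(a has_sum (infsum d Zn + 1 * f x)) Zn"
  proof -
    have "((\<lambda>k. d k + \<chi>f (w *\<^sub>R x - k) * f x) has_sum (infsum d Zn + 1 * f x)) Zn"
      by (intro has_sum_add has_sum_cmult_left sum1 has_sum_infsum d)
    then show ?thesis by (simp add: d_def)
  qed
  then have "kantorovich \<chi>f w f x = infsum d Zn + f x"
    unfolding kantorovich_def a_def[symmetric] by (simp add: infsumI)
  ultimately show ?thesis using real by (simp add: ennreal_leI)
qed simp

text \<open>The moment of order \<alpha> controls lattice points away from \<open>u\<close>, and
  local boundedness the remaining one: a ball of radius at most 1/2 around \<open>u\<close> contains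
  at most one lattice point.\<close>

lemma kernel_sum_bound:
  fixes \<chi>f :: "real^'n \<Rightarrow> real"
  assumes "is_kernel \<alpha> \<chi>f" "0 \<le> \<alpha>"
  obtains M where "0 < M" "\<And>u F. finite F \<Longrightarrow> F \<subseteq> Zn \<Longrightarrow> (\<Sum>k\<in>F. \<bar>\<chi>f (u - k)\<bar>) \<le> M"
proof -
  obtain \<delta> M1 where \<delta>: "0 < \<delta>" and M1: "\<And>u. norm u < \<delta> \<Longrightarrow> \<bar>\<chi>f u\<bar> \<le> M1"
    using assms(1) unfolding is_kernel_def by blast
  obtain M2 where M2: "\<And>u. (\<lambda>k. \<bar>\<chi>f (u - k)\<bar> * npow (norm (u - k)) \<alpha>) summable_on Zn"
     "\<And>u. (\<Sum>\<^sub>\<infinity>k\<in>Zn. \<bar>\<chi>f (u - k)\<bar> * npow (norm (u - k)) \<alpha>) \<le> M2"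
    using assms(1) unfolding is_kernel_def by blast
  \<comment> \<open>Two lattice points within \<open>d\<close> of \<open>u\<close> have distance
    below 2d \<le> 1, so their integer coordinates agree.\<close>
  define d where "d = min \<delta> (1/2)"
  have d: "0 < d" "d \<le> \<delta>" "d \<le> 1/2" using \<delta> by (auto simp: d_def)
  have M1_0: "0 \<le> M1" using M1[of 0] \<delta> by simp
  have npow0: "0 \<le> npow s \<alpha>" for s by (simp add: npow_def)
  have far: "\<bar>\<chi>f v\<bar> \<le> d powr (-\<alpha>) * (\<bar>\<chi>f v\<bar> * npow (norm v) \<alpha>)" if "d \<le> norm v" for v
  proof -
    have "1 \<le> d powr (-\<alpha>) * npow (norm v) \<alpha>"
    proof (cases "\<alpha> = 0")
      case False
      have "1 = d powr (-\<alpha>) * d powr \<alpha>" using d by (simp flip: powr_add)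
      also have "\<dots> \<le> d powr (-\<alpha>) * norm v powr \<alpha>"
        using d that assms(2) by (intro mult_left_mono powr_mono2) auto
      finally show ?thesis using False by (simp add: npow_def)
    qed (use d in \<open>simp add: npow_def\<close>)
    then have "\<bar>\<chi>f v\<bar> * 1 \<le> \<bar>\<chi>f v\<bar> * (d powr (-\<alpha>) * npow (norm v) \<alpha>)" by (intro mult_left_mono) auto
    then show ?thesis by (simp add: mult_ac)
  qed
  have bound: "(\<Sum>k\<in>F. \<bar>\<chi>f (u - k)\<bar>) \<le> M1 + d powr (-\<alpha>) * M2" if F: "finite F" "F \<subseteq> Zn" for u F
  proof -
    define N where "N = {k \<in> F. norm (u - k) < d}"
    have uniq: "k = l" if "k \<in> N" "l \<in> N" for k l
    proof -
      have "norm (k - l) < 1"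
      proof -
        have "norm (k - l) \<le> norm (u - l) + norm (u - k)"
          using norm_triangle_ineq4[of "u - l" "u - k"] by simp
        then show ?thesis using that d by (auto simp: N_def)
      qed
      then have lt: "\<bar>k $ i - l $ i\<bar> < 1" for i
        using component_le_norm_cart[of "k - l" i] by simp
      have "k $ i = l $ i" for i
      proof -
        have "k \<in> Zn" "l \<in> Zn" using that F by (auto simp: N_def)
        then have "k $ i \<in> \<int>" "l $ i \<in> \<int>" by (auto simp: Zn_def)
        then obtain a b where "k $ i = of_int a" "l $ i = of_int b"
          by (auto elim!: Ints_cases)
        then show ?thesis using lt[of i] by (simp flip: of_int_diff of_int_abs)
      qed
      then show ?thesis by (simp add: vec_eq_iff)
    qed
    have "(\<Sum>k\<in>F. \<bar>\<chi>f (u - k)\<bar>) = (\<Sum>k\<in>N. \<bar>\<chi>f (u - k)\<bar>) + (\<Sum>k\<in>F - N. \<bar>\<chi>f (u - k)\<bar>)"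
      using F by (subst sum.subset_diff[of N F]) (auto simp: N_def)
    also have "(\<Sum>k\<in>N. \<bar>\<chi>f (u - k)\<bar>) \<le> M1"
    proof (cases "N = {}")
      case False
      then obtain k where "k \<in> N" by blast
      with uniq have "N = {k}" by blast
      then show ?thesis using d by (auto simp: N_def intro!: M1)
    qed (simp add: M1_0)
    also have "(\<Sum>k\<in>F - N. \<bar>\<chi>f (u - k)\<bar>) \<le> (\<Sum>k\<in>F - N. d powr (-\<alpha>) * (\<bar>\<chi>f (u - k)\<bar> * npow (norm (u - k)) \<alpha>))"
      by (intro sum_mono far) (auto simp: N_def)
    also have "\<dots> = d powr (-\<alpha>) * (\<Sum>k\<in>F - N. \<bar>\<chi>f (u - k)\<bar> * npow (norm (u - k)) \<alpha>)"
      by (simp add: sum_distrib_left)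
    also have "(\<Sum>k\<in>F - N. \<bar>\<chi>f (u - k)\<bar> * npow (norm (u - k)) \<alpha>) \<le> M2"
      using F npow0 by (intro order_trans[OF finite_sum_le_infsum[OF M2(1)] M2(2)]) auto
    finally show ?thesis by (simp add: mult_left_mono)
  qed
  show ?thesis
  proof (rule that[of "\<bar>M1 + d powr (-\<alpha>) * M2\<bar> + 1"])
    fix u and F :: "(real^'n) set" assume "finite F" "F \<subseteq> Zn"
    then show "(\<Sum>k\<in>F. \<bar>\<chi>f (u - k)\<bar>) \<le> \<bar>M1 + d powr (-\<alpha>) * M2\<bar> + 1"
      using bound[of F u] by linarith
  qed auto
qed

text \<open>A Lebesgue measurable kernel is replaced by a Borel one satisfying the summability bound everywhere:
  since the periodization is itself periodic, cutting off where it exceeds the bound acts on whole lattice orbits.\<close>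
lemma borel_kernel_majorant:
  fixes \<chi>f :: "real^'n \<Rightarrow> real"
  assumes int: "integrable lebesgue \<chi>f"
    and M: "\<And>u F. finite F \<Longrightarrow> F \<subseteq> Zn \<Longrightarrow> (\<Sum>k\<in>F. \<bar>\<chi>f (u - k)\<bar>) \<le> M"
  obtains X where "X \<in> borel_measurable borel" "AE v in lborel. X v = ennreal \<bar>\<chi>f v\<bar>"
    "\<And>x. (\<integral>\<^sup>+t. X (x - vec_floor t) \<partial>lborel) \<le> ennreal M" "(\<integral>\<^sup>+t. X t \<partial>lborel) < top"
proof -
  have "\<chi>f \<in> borel_measurable lebesgue" using int by auto
  from completion_ex_borel_measurable_real[OF this]
  obtain \<psi> where [measurable]: "\<psi> \<in> borel_measurable borel" and ae: "AE v in lborel. \<chi>f v = \<psi> v"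
    by auto
  define B where "B x = (\<integral>\<^sup>+t. ennreal \<bar>\<psi> (x - vec_floor t)\<bar> \<partial>lborel)" for x
  have [measurable]: "B \<in> borel_measurable borel" unfolding B_def[abs_def] by measurable
  have B_per: "B (x - vec_floor t) = B x" for x t
    unfolding B_def using nn_integral_periodic[of "\<lambda>v. ennreal \<bar>\<psi> v\<bar>" x t] by simp
  define X where "X v = ennreal \<bar>\<psi> v\<bar> * indicator {v. B v \<le> ennreal M} v" for v
  have X [measurable]: "X \<in> borel_measurable borel" unfolding X_def[abs_def] by measurable
  \<comment> \<open>Only countably many translates of the exceptional null set occur. The factor 1
    matches the form of \<open>AE_lborel_affine\<close>.\<close>
  have "AE u in lborel. \<forall>k\<in>Zn. \<chi>f (1 *\<^sub>R u - k) = \<psi> (1 *\<^sub>R u - k)"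
    unfolding AE_ball_countable[OF countable_Zn] using AE_lborel_affine[OF ae, of 1] by auto
  then have B_le: "AE u in lborel. B u \<le> ennreal M"
  proof eventually_elim
    case (elim u)
    have "(\<Sum>k\<in>F. ennreal \<bar>\<psi> (u - k)\<bar>) \<le> ennreal M" if F: "finite F" "F \<subseteq> Zn" for F
    proof -
      have "(\<Sum>k\<in>F. ennreal \<bar>\<psi> (u - k)\<bar>) = ennreal (\<Sum>k\<in>F. \<bar>\<psi> (u - k)\<bar>)" by simp
      also have "(\<Sum>k\<in>F. \<bar>\<psi> (u - k)\<bar>) = (\<Sum>k\<in>F. \<bar>\<chi>f (u - k)\<bar>)"
        using elim F by (intro sum.cong) auto
      finally show ?thesis using M[OF F, of u] by (simp add: ennreal_leI)
    qed
    then show ?case unfolding B_def by (intro nn_integral_vec_floor_le[of "\<lambda>k. ennreal \<bar>\<psi> (u - k)\<bar>"]) auto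
  qed
  show ?thesis
  proof (rule that[OF X])
    show "AE v in lborel. X v = ennreal \<bar>\<chi>f v\<bar>"
      using ae B_le by eventually_elim (simp add: X_def)
    show "(\<integral>\<^sup>+t. X (x - vec_floor t) \<partial>lborel) \<le> ennreal M" for x
    proof -
      have "(\<integral>\<^sup>+t. X (x - vec_floor t) \<partial>lborel) = (\<integral>\<^sup>+t. ennreal \<bar>\<psi> (x - vec_floor t)\<bar> * indicator {v. B v \<le> ennreal M} x \<partial>lborel)"
        unfolding X_def by (auto simp: B_per indicator_def intro!: nn_integral_cong)
      also have "\<dots> = B x * indicator {v. B v \<le> ennreal M} x"
        unfolding B_def by (rule nn_integral_multc) measurable
      also have "\<dots> \<le> ennreal M" by (auto simp: indicator_def)
      finally show ?thesis .
    qed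
    have "(\<integral>\<^sup>+t. X t \<partial>lborel) \<le> (\<integral>\<^sup>+t. ennreal \<bar>\<psi> t\<bar> \<partial>lborel)"
      by (intro nn_integral_mono) (auto simp: X_def indicator_def)
    also have "\<dots> = (\<integral>\<^sup>+t. ennreal \<bar>\<chi>f t\<bar> \<partial>lborel)"
      using ae by (intro nn_integral_cong_AE) (auto elim!: eventually_mono)
    also have "\<dots> = (\<integral>\<^sup>+t. ennreal (norm (\<chi>f t)) \<partial>lebesgue)" by (simp add: nn_integral_completion)
    also have "\<dots> < top" using int by (simp add: integrable_iff_bounded)
    finally show "(\<integral>\<^sup>+t. X t \<partial>lborel) < top" .
  qed
qed

text \<open>Almost every x avoids the countably many null sets where some w x - k is exceptional for
  \<open>X\<close>. The integrals over the cells do not distinguish f from h.\<close>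

lemma kantorovich_diff_le_osc_op:
  fixes f h :: "real^'n \<Rightarrow> real"
  assumes f: "f \<in> borel_measurable lebesgue" and [measurable]: "h \<in> borel_measurable borel" and fh: "AE x in lborel. f x = h x"
    and sum1: "\<And>u. ((\<lambda>k. \<chi>f (u - k)) has_sum 1) Zn"
    and [measurable]: "X \<in> borel_measurable borel" and X: "AE v in lborel. X v = ennreal \<bar>\<chi>f v\<bar>" and "0 < w"
  shows "AE x in lborel. ennreal \<bar>kantorovich \<chi>f w f x - f x\<bar> \<le> osc_op X w h x"
proof -
  have "AE x in lborel. \<forall>k\<in>Zn. X (w *\<^sub>R x - k) = ennreal \<bar>\<chi>f (w *\<^sub>R x - k)\<bar>"
    unfolding AE_ball_countable[OF countable_Zn] using AE_lborel_affine[OF X \<open>0 < w\<close>] by auto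
  then show ?thesis using fh
  proof eventually_elim
    case (elim x)
    show ?case
    proof (rule kantorovich_diff_le[OF f \<open>0 < w\<close> sum1])
      fix F :: "(real^'n) set" assume F: "finite F" "F \<subseteq> Zn"
      have "(\<integral>\<^sup>+t. indicator (cbox a b) t * ennreal \<bar>f t - f x\<bar> \<partial>lborel) = (\<integral>\<^sup>+t. indicator (cbox a b) t * ennreal \<bar>h t - h x\<bar> \<partial>lborel)" for a b
        using fh elim by (intro nn_integral_cong_AE) (auto elim!: eventually_mono)
      moreover have "ennreal \<bar>\<chi>f (w *\<^sub>R x - k)\<bar> = X (w *\<^sub>R x - k)" if "k \<in> F" for k using elim that F by auto
      ultimately show "(\<Sum>k\<in>F. ennreal \<bar>\<chi>f (w *\<^sub>R x - k)\<bar> * (ennreal (w ^ CARD('n)) *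
         (\<integral>\<^sup>+t. indicator (cbox ((1 / w) *\<^sub>R k) ((1 / w) *\<^sub>R (k + 1))) t * ennreal \<bar>f t - f x\<bar> \<partial>lborel))) \<le> osc_op X w h x"
        using sum_cells_le_kant_op[of X "\<lambda>t. ennreal \<bar>h t - h x\<bar>" w F x] F \<open>0 < w\<close>
        by (simp add: osc_op_def)
    qed
  qed
qed

theorem theorem4p4:
  fixes P :: "'n::{finite,linorder} \<Rightarrow> real"
    and \<chi>f :: "real^'n::{finite,linorder} \<Rightarrow> real"
    and f :: "real^'n::{finite,linorder} \<Rightarrow> real"
    and \<alpha> :: real
  assumes "\<forall>i. 1 \<le> P i"
    and "mono P"
    and "\<alpha> \<ge> 0"
    and "is_kernel \<alpha> \<chi>f"
    and "in_mixed_Lp P f"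
  shows "((\<lambda>w. mixed_norm P (\<lambda>x. kantorovich \<chi>f w f x - f x)) \<longlongrightarrow> 0) at_top"
proof -
  define js where "js = sorted_list_of_set (UNIV :: 'n set)"
  have P: "1 \<le> P i" for i using assms(1) by blast
  have js: "set js = UNIV" "distinct js" by (auto simp: js_def)
  \<comment> \<open>Monotonicity of \<open>P\<close> makes the exponents increase in the order of
    integration, as the Jensen step requires.\<close>
  have srt: "sorted (map P js)"
    unfolding js_def by (rule sorted_map_mono) (use \<open>mono P\<close> in \<open>auto simp: monoD intro: mono_onI\<close>)
  have f: "f \<in> borel_measurable lebesgue" and fin: "mixed_norm P f < top"
    using assms(5) by (auto simp: in_mixed_Lp_def)
  from completion_ex_borel_measurable_real[OF f]
  obtain h where h [measurable]: "h \<in> borel_measurable borel" and fh: "AE x in lborel. f x = h x" by auto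
  obtain M where M: "0 < M" "\<And>u F. finite F \<Longrightarrow> F \<subseteq> Zn \<Longrightarrow> (\<Sum>k\<in>F. \<bar>\<chi>f (u - k)\<bar>) \<le> M"
    by (rule kernel_sum_bound[OF assms(4,3)]) (rule that)
  have int: "integrable lebesgue \<chi>f" and sum1: "\<And>u. ((\<lambda>k. \<chi>f (u - k)) has_sum 1) Zn"
    using assms(4) by (auto simp: is_kernel_def)
  obtain X where X: "X \<in> borel_measurable borel" "AE v in lborel. X v = ennreal \<bar>\<chi>f v\<bar>"
    "\<And>x. (\<integral>\<^sup>+t. X (x - vec_floor t) \<partial>lborel) \<le> ennreal M" "(\<integral>\<^sup>+t. X t \<partial>lborel) < top"
    by (rule borel_kernel_majorant[OF int M(2)]) (assumption, assumption, rule that)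
  \<comment> \<open>Only this inequality is needed for the Borel representative: it transfers
    finiteness of the norm from f to h.\<close>
  have "mixnorm_aux js P (\<lambda>x. ennreal \<bar>h x\<bar>) 0 \<le> mixed_norm P f"
    unfolding mixed_norm_def js_def[symmetric]
    by (rule mixnorm_aux_mono_AE[OF P js(1)]) (use fh in \<open>auto elim!: eventually_mono\<close>)
  then have lim: "((\<lambda>w. mixnorm_aux js P (osc_op X w h) 0) \<longlongrightarrow> 0) at_top"
    using fin by (intro osc_op_tendsto[OF P srt js(2,1) X(1,3) M(1) X(4) h]) auto
  have le: "\<forall>\<^sub>F w in at_top. mixed_norm P (\<lambda>x. kantorovich \<chi>f w f x - f x) \<le> mixnorm_aux js P (osc_op X w h) 0"
    using eventually_gt_at_top[of 0]
  proof eventually_elim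
    case (elim w)
    show ?case unfolding mixed_norm_def js_def[symmetric]
      by (rule mixnorm_aux_mono_AE[OF P js(1) kantorovich_diff_le_osc_op[OF f h fh sum1 X(1,2) elim]])
  qed
  show ?thesis
    by (rule tendsto_sandwich[OF _ le tendsto_const lim]) simp
qed

end
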